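(* Let $n$ be sufficiently large, and let Breaker play according to the strategy described in the context, with no isolation turns occurring. Let $t_0$ be a turn with $\mathrm{POT}_{t_0}>n$, $\mathrm{POT}_{t_0-1}\le n$, and $\mathrm{POT}_t<2n$ for all $t<t_0$, and let $t^*$ be defined as in the context. If the game has not ended before turn $t^*$, then $\mathrm{POT}_{t^*}\le\mathrm{POT}_{t_0-1}$.
   Context: Setting: the $(n,q)$-triangle game on $K_n$ with vertex set $V$, $|V|=n$: in every turn Maker claims one unclaimed edge, then Breaker claims $q$ unclaimed edges; Maker wins if he claims a triangle. $\deg_M(v),\deg_B(v)$ are Maker's and Breaker's degrees of $v$; subscript $t$ means "directly after turn $t$". Let $\epsilon^*>0$, $\beta=\frac83+\epsilon^*$, $q=\sqrt{\beta n}$, $\delta\in(0,1-\frac{8}{3\beta})$, $p_0=\frac{8}{\beta(1-\delta)(3+\delta)}$, $\mu=1+\frac{6\beta\ln n}{\delta q}$. For $v\in V$: $\deg^*(v)=n-p_0\left(\frac{q^2(1-\delta)(3+\delta)}{8}-\deg_M(v)\left(q-\frac{\deg_M(v)}{2}\right)\right)$, $d(v)=\deg^*(v)-\deg_B(v)$, $\mathrm{pot}(v)=0$ if $\deg_M(v)+\deg_B(v)=n-1$ and $\mathrm{pot}(v)=\mu^{d(v)/q}$ otherwise; $\mathrm{pot}(\{x,y\})=\mathrm{pot}(x)+\mathrm{pot}(y)$ for unclaimed edges; $\mathrm{POT}_t=\sum_{v}\mathrm{pot}_t(v)$. Breaker's strategy: in turn $t$, with Maker's edge $\{u,v\}$,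 Part 1: Breaker claims $\deg_{M,t-1}(v)$ edges at $u$ and $\deg_{M,t-1}(u)$ edges at $v$ closing all new Maker paths of length $2$ (closing edges; $u$ resp. $v$ is the head, the other endpoint the tail); if such an edge is already claimed he claims an arbitrary unclaimed edge at $u$ (resp. $v$); an isolation turn is one in which no unclaimed edge at $u$ (resp. $v$) is left for this. Part 2: with the remaining $f(t)=q-\deg_{M,t-1}(u)-\deg_{M,t-1}(v)$ edges, Breaker iteratively claims an unclaimed edge of maximum current potential (free edges). Potential bookkeeping for turn $t$ and $w\in V$: $I_t(w)$ is the increase of the potential of $w$ caused by Maker's edge; $D^{\mathrm{free}}_t(w)$, $D^{\mathrm{head}}_t(w)$ are the decreases of the potential of $w$ caused by free edges, resp. by closing edges with head $w$; these are measured via the change of $\mu^{d(w)/q}$, the additional drop of the potential to $0$ when the last unclaimed edge at $w$ is claimed being accounted separately. $U_t(w)=\min\{I_t(w),D^{\mathrm{head}}_t(w)\}$. Omitting $w$ means summing over all $w\in V$. Fix $\eta$ with $0<\eta<1-\mu p_0$ (possible for large $n$). Turn $t$ is critical if $I_t-U_t-(1-\eta)D^{\mathrm{free}}_t>0$. Fix constants $\gamma\in(0,1)$ and $\epsilon>0$ with $\frac{1-\eta}{(1+\epsilon)\mu p_0}>1$, and let $c=\left\lceil\frac{1-\log(1-\gamma)}{\log(1-\eta)-\log(1+\epsilon)-\log(\mu p_0)}\right\rceil$. For $t_0$ as in the claim, let $\{u,v\}$ be Maker's edge in turn $t_0$, labelled so that $\mathrm{pot}_{t_0-1}(u)\ge\mathrm{pot}_{t_0-1}(v)$.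 Let $t_1$ be the first turn $\ge t_0$ with $\mathrm{pot}_{t_1}(u)\le(1-\gamma)\mathrm{pot}_{t_0-1}(u)$; $t_2$ the first turn after $t_0$ with $\mathrm{pot}_{t_2}(w)\ge(1+\epsilon)\mathrm{pot}_s(w)$ for some $w\in V$ and some turn $s$ with $t_0\le s<t_2$; $t_3$ the $c$-th critical turn among the turns $\ge t_0$. If the game ends before $t_i$ is reached, $t_i=\infty$. Let $t^*=\min(t_1,t_2,t_3)$.
   Formalization: The bias q is taken as √(βn) rounded up to an integer in all formulas, and in the definition of t₂ only vertices w with pot_s(w) > 0 count (a vertex of potential 0 would satisfy the inequality trivially); "log" in c is read as base 2. *)

theory Defs
  imports
    Complex_Main
    "HOL-Library.Extended_Nat"
    "HOL-Library.Ramsey"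
begin

type_synonym edge = "nat set"

definition K :: "nat \<Rightarrow> edge set" where
  "K n = nsets {..<n} 2"

definition deg :: "edge set \<Rightarrow> nat \<Rightarrow> nat" where
  "deg E v = card {e \<in> E. v \<in> e}"

definition has_triangle :: "edge set \<Rightarrow> bool" where
  "has_triangle E \<longleftrightarrow> (\<exists>x y z. x \<noteq> y \<and> y \<noteq> z \<and> x \<noteq> z \<and> {x, y} \<in> E \<and> {y, z} \<in> E \<and> {x, z} \<in> E)"


subsection \<open>Parameters and potentials\<close>

text \<open>The bias \<open>q = sqrt (\<beta> n)\<close> is the number of edges Breaker claims per turn, so it is rounded
  up to a natural number; the rounded value is used as \<open>q\<close> in all formulas.\<close>

definition bias :: "real \<Rightarrow> nat \<Rightarrow> nat" where
  "bias \<beta> n = nat \<lceil>sqrt (\<beta> * real n)\<rceil>"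

definition p0 :: "real \<Rightarrow> real \<Rightarrow> real" where
  "p0 \<beta> \<delta> = 8 / (\<beta> * (1 - \<delta>) * (3 + \<delta>))"

definition mu :: "real \<Rightarrow> real \<Rightarrow> nat \<Rightarrow> real" where
  "mu \<beta> \<delta> n = 1 + 6 * \<beta> * ln (real n) / (\<delta> * real (bias \<beta> n))"

text \<open>In the following, \<open>M\<close> and \<open>B\<close> are the sets of edges claimed so far by Maker and Breaker.\<close>

definition deg_star :: "real \<Rightarrow> real \<Rightarrow> nat \<Rightarrow> edge set \<Rightarrow> nat \<Rightarrow> real" where
  "deg_star \<beta> \<delta> n M v =
    (let q = real (bias \<beta> n); m = real (deg M v)
     in real n - p0 \<beta> \<delta> * (q\<^sup>2 * (1 - \<delta>) * (3 + \<delta>) / 8 - m * (q - m / 2)))"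

definition danger :: "real \<Rightarrow> real \<Rightarrow> nat \<Rightarrow> edge set \<Rightarrow> edge set \<Rightarrow> nat \<Rightarrow> real" where
  "danger \<beta> \<delta> n M B v = deg_star \<beta> \<delta> n M v - real (deg B v)"

text \<open>The quantity \<open>\<mu> powr (d v / q)\<close>, without the drop to 0 at vertices having no unclaimed edge.\<close>

definition raw_pot :: "real \<Rightarrow> real \<Rightarrow> nat \<Rightarrow> edge set \<Rightarrow> edge set \<Rightarrow> nat \<Rightarrow> real" where
  "raw_pot \<beta> \<delta> n M B v = mu \<beta> \<delta> n powr (danger \<beta> \<delta> n M B v / real (bias \<beta> n))"

definition pot :: "real \<Rightarrow> real \<Rightarrow> nat \<Rightarrow> edge set \<Rightarrow> edge set \<Rightarrow> nat \<Rightarrow> real" where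
  "pot \<beta> \<delta> n M B v = (if deg M v + deg B v = n - 1 then 0 else raw_pot \<beta> \<delta> n M B v)"

definition edge_pot :: "real \<Rightarrow> real \<Rightarrow> nat \<Rightarrow> edge set \<Rightarrow> edge set \<Rightarrow> edge \<Rightarrow> real" where
  "edge_pot \<beta> \<delta> n M B e = (\<Sum>x\<in>e. pot \<beta> \<delta> n M B x)"


subsection \<open>The game and Breaker's strategy\<close>

text \<open>\<open>closing a w\<close> is the set of edges claimed by Breaker in Part 1 of turn \<open>a\<close> with head \<open>w\<close>
  (this includes the edges claimed at \<open>w\<close> in place of already claimed ones); \<open>free a\<close> lists the
  edges of Part 2 in the order in which they are claimed.\<close>

record turn =
  maker_edge :: edge
  closing :: "nat \<Rightarrow> edge set"
  free :: "edge list"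

definition closing_edges :: "turn \<Rightarrow> edge set" where
  "closing_edges a = (\<Union>w. closing a w)"

definition breaker_edges :: "turn \<Rightarrow> edge set" where
  "breaker_edges a = closing_edges a \<union> set (free a)"

text \<open>A game is the list of its turns played so far; turns are numbered from 1, and
  \<open>maker_graph g t\<close> and \<open>breaker_graph g t\<close> are the graphs directly after turn \<open>t\<close>.\<close>

definition turn_at :: "turn list \<Rightarrow> nat \<Rightarrow> turn" where
  "turn_at g t = g ! (t - 1)"

definition maker_graph :: "turn list \<Rightarrow> nat \<Rightarrow> edge set" where
  "maker_graph g t = (\<Union>s\<in>{1..t}. {maker_edge (turn_at g s)})"

definition breaker_graph :: "turn list \<Rightarrow> nat \<Rightarrow> edge set" where
  "breaker_graph g t = (\<Union>s\<in>{1..t}. breaker_edges (turn_at g s))"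

text \<open>The rules of the game with bias \<open>q\<close>. The game is over as soon as Maker owns a triangle or all
  edges are claimed; if fewer than \<open>q\<close> edges are left for Breaker, he claims all of them.\<close>

definition legal_turn :: "nat \<Rightarrow> nat \<Rightarrow> edge set \<Rightarrow> edge set \<Rightarrow> turn \<Rightarrow> bool" where
  "legal_turn n q M B a \<longleftrightarrow>
    \<not> has_triangle M \<and>
    maker_edge a \<in> K n - (M \<union> B) \<and>
    (let R = K n - (insert (maker_edge a) M \<union> B)
     in breaker_edges a \<subseteq> R \<and> card (breaker_edges a) = min q (card R))"

text \<open>The unclaimed edges at \<open>u\<close> after Maker has claimed \<open>{u, v}\<close>.\<close>

definition available :: "nat \<Rightarrow> edge set \<Rightarrow> edge set \<Rightarrow> nat \<Rightarrow> nat \<Rightarrow> edge set" where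
  "available n M B u v = {e \<in> K n - (insert {u, v} M \<union> B). u \<in> e}"

definition isolation :: "nat \<Rightarrow> edge set \<Rightarrow> edge set \<Rightarrow> turn \<Rightarrow> bool" where
  "isolation n M B a \<longleftrightarrow>
    (\<exists>u v. maker_edge a = {u, v} \<and> card (available n M B u v) < deg M v)"

text \<open>Part 1 at the head \<open>u\<close>: \<open>C\<close> consists of \<open>deg M v\<close> edges at \<open>u\<close>, among them all unclaimed
  edges closing a new Maker path \<open>u, v, x\<close>; the others are arbitrary.\<close>

definition part1 :: "nat \<Rightarrow> edge set \<Rightarrow> edge set \<Rightarrow> nat \<Rightarrow> nat \<Rightarrow> edge set \<Rightarrow> bool" where
  "part1 n M B u v C \<longleftrightarrow>
    C \<subseteq> available n M B u v \<and>
    card C = deg M v \<and>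
    {e \<in> available n M B u v. \<exists>x. e = {u, x} \<and> {v, x} \<in> M} \<subseteq> C"

text \<open>Part 2, from the position \<open>(M, B)\<close> reached after Part 1. The number of free edges is not
  mentioned, since the total number of Breaker's edges is fixed by the rules of the game.\<close>

definition part2 :: "real \<Rightarrow> real \<Rightarrow> nat \<Rightarrow> edge set \<Rightarrow> edge set \<Rightarrow> edge list \<Rightarrow> bool" where
  "part2 \<beta> \<delta> n M B es \<longleftrightarrow>
    (\<forall>i < length es.
      let B' = B \<union> set (take i es); R = K n - (M \<union> B')
      in es ! i \<in> R \<and> (\<forall>e\<in>R. edge_pot \<beta> \<delta> n M B' e \<le> edge_pot \<beta> \<delta> n M B' (es ! i)))"

text \<open>The strategy is only specified outside isolation turns.\<close>

definition strategy_turn :: "real \<Rightarrow> real \<Rightarrow> nat \<Rightarrow> edge set \<Rightarrow> edge set \<Rightarrow> turn \<Rightarrow> bool" where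
  "strategy_turn \<beta> \<delta> n M B a \<longleftrightarrow>
    (\<forall>w. w \<notin> maker_edge a \<longrightarrow> closing a w = {}) \<and>
    (\<not> isolation n M B a \<longrightarrow>
      (\<forall>u v. maker_edge a = {u, v} \<longrightarrow> part1 n M B u v (closing a u)) \<and>
      part2 \<beta> \<delta> n (insert (maker_edge a) M) (B \<union> closing_edges a) (free a))"

definition strategy_game :: "real \<Rightarrow> real \<Rightarrow> nat \<Rightarrow> turn list \<Rightarrow> bool" where
  "strategy_game \<beta> \<delta> n g \<longleftrightarrow>
    (\<forall>t\<in>{1..length g}.
      legal_turn n (bias \<beta> n) (maker_graph g (t - 1)) (breaker_graph g (t - 1)) (turn_at g t) \<and>
      strategy_turn \<beta> \<delta> n (maker_graph g (t - 1)) (breaker_graph g (t - 1)) (turn_at g t))"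

definition isolation_turn :: "nat \<Rightarrow> turn list \<Rightarrow> nat \<Rightarrow> bool" where
  "isolation_turn n g t \<longleftrightarrow>
    isolation n (maker_graph g (t - 1)) (breaker_graph g (t - 1)) (turn_at g t)"


subsection \<open>Potential bookkeeping\<close>

definition pot_at :: "real \<Rightarrow> real \<Rightarrow> nat \<Rightarrow> turn list \<Rightarrow> nat \<Rightarrow> nat \<Rightarrow> real" where
  "pot_at \<beta> \<delta> n g t v = pot \<beta> \<delta> n (maker_graph g t) (breaker_graph g t) v"

definition POT :: "real \<Rightarrow> real \<Rightarrow> nat \<Rightarrow> turn list \<Rightarrow> nat \<Rightarrow> real" where
  "POT \<beta> \<delta> n g t = (\<Sum>v<n. pot_at \<beta> \<delta> n g t v)"

definition incr :: "real \<Rightarrow> real \<Rightarrow> nat \<Rightarrow> turn list \<Rightarrow> nat \<Rightarrow> nat \<Rightarrow> real" where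
  "incr \<beta> \<delta> n g t w =
    raw_pot \<beta> \<delta> n (maker_graph g t) (breaker_graph g (t - 1)) w -
    raw_pot \<beta> \<delta> n (maker_graph g (t - 1)) (breaker_graph g (t - 1)) w"

text \<open>The decreases caused by the single edges telescope. In Part 1 an endpoint of Maker's edge is
  never a tail, hence all edges claimed at it in Part 1 have it as head.\<close>

definition decr_head :: "real \<Rightarrow> real \<Rightarrow> nat \<Rightarrow> turn list \<Rightarrow> nat \<Rightarrow> nat \<Rightarrow> real" where
  "decr_head \<beta> \<delta> n g t w =
    raw_pot \<beta> \<delta> n (maker_graph g t) (breaker_graph g (t - 1)) w -
    raw_pot \<beta> \<delta> n (maker_graph g t) (breaker_graph g (t - 1) \<union> closing (turn_at g t) w) w"

definition decr_free :: "real \<Rightarrow> real \<Rightarrow> nat \<Rightarrow> turn list \<Rightarrow> nat \<Rightarrow> nat \<Rightarrow> real" where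
  "decr_free \<beta> \<delta> n g t w =
    raw_pot \<beta> \<delta> n (maker_graph g t) (breaker_graph g (t - 1) \<union> closing_edges (turn_at g t)) w -
    raw_pot \<beta> \<delta> n (maker_graph g t) (breaker_graph g t) w"

definition U :: "real \<Rightarrow> real \<Rightarrow> nat \<Rightarrow> turn list \<Rightarrow> nat \<Rightarrow> nat \<Rightarrow> real" where
  "U \<beta> \<delta> n g t w = min (incr \<beta> \<delta> n g t w) (decr_head \<beta> \<delta> n g t w)"

definition critical :: "real \<Rightarrow> real \<Rightarrow> nat \<Rightarrow> real \<Rightarrow> turn list \<Rightarrow> nat \<Rightarrow> bool" where
  "critical \<beta> \<delta> n \<eta> g t \<longleftrightarrow>
    (\<Sum>w<n. incr \<beta> \<delta> n g t w) - (\<Sum>w<n. U \<beta> \<delta> n g t w)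
      - (1 - \<eta>) * (\<Sum>w<n. decr_free \<beta> \<delta> n g t w) > 0"


subsection \<open>The stopping turns\<close>

text \<open>\<open>\<infinity>\<close> if there is no such turn in the game.\<close>

definition first_turn :: "turn list \<Rightarrow> (nat \<Rightarrow> bool) \<Rightarrow> enat" where
  "first_turn g P = Inf (enat ` {t \<in> {1..length g}. P t})"

definition t1 :: "real \<Rightarrow> real \<Rightarrow> nat \<Rightarrow> real \<Rightarrow> turn list \<Rightarrow> nat \<Rightarrow> nat \<Rightarrow> enat" where
  "t1 \<beta> \<delta> n \<gamma> g t0 u =
    first_turn g (\<lambda>t. t0 \<le> t \<and> pot_at \<beta> \<delta> n g t u \<le> (1 - \<gamma>) * pot_at \<beta> \<delta> n g (t0 - 1) u)"

text \<open>A vertex of potential 0 keeps potential 0 forever; such vertices trivially satisfy the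
  inequality and are not counted as having increased their potential by a factor \<open>1 + \<epsilon>\<close>.\<close>

definition t2 :: "real \<Rightarrow> real \<Rightarrow> nat \<Rightarrow> real \<Rightarrow> turn list \<Rightarrow> nat \<Rightarrow> enat" where
  "t2 \<beta> \<delta> n \<epsilon> g t0 =
    first_turn g (\<lambda>t. t0 < t \<and>
      (\<exists>w<n. \<exists>s. t0 \<le> s \<and> s < t \<and> 0 < pot_at \<beta> \<delta> n g s w \<and>
        pot_at \<beta> \<delta> n g t w \<ge> (1 + \<epsilon>) * pot_at \<beta> \<delta> n g s w))"

definition t3 :: "real \<Rightarrow> real \<Rightarrow> nat \<Rightarrow> real \<Rightarrow> nat \<Rightarrow> turn list \<Rightarrow> nat \<Rightarrow> enat" where
  "t3 \<beta> \<delta> n \<eta> c g t0 =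
    first_turn g (\<lambda>t. t0 \<le> t \<and> critical \<beta> \<delta> n \<eta> g t \<and>
      card {s \<in> {t0..t}. critical \<beta> \<delta> n \<eta> g s} = c)"

text \<open>The logarithms are binary: the numerator is the logarithm of \<open>2 / (1 - \<gamma>)\<close>.\<close>

definition crit_bound :: "real \<Rightarrow> real \<Rightarrow> nat \<Rightarrow> real \<Rightarrow> real \<Rightarrow> real \<Rightarrow> nat" where
  "crit_bound \<beta> \<delta> n \<eta> \<gamma> \<epsilon> =
    nat \<lceil>(1 - log 2 (1 - \<gamma>)) /
      (log 2 (1 - \<eta>) - log 2 (1 + \<epsilon>) - log 2 (mu \<beta> \<delta> n * p0 \<beta> \<delta>))\<rceil>"

definition t_star ::
  "real \<Rightarrow> real \<Rightarrow> nat \<Rightarrow> real \<Rightarrow> real \<Rightarrow> real \<Rightarrow> turn list \<Rightarrow> nat \<Rightarrow> nat \<Rightarrow> enat" where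
  "t_star \<beta> \<delta> n \<eta> \<gamma> \<epsilon> g t0 u =
    min (t1 \<beta> \<delta> n \<gamma> g t0 u)
      (min (t2 \<beta> \<delta> n \<epsilon> g t0) (t3 \<beta> \<delta> n \<eta> (crit_bound \<beta> \<delta> n \<eta> \<gamma> \<epsilon>) g t0))"

end

theory Submission
  imports Defs "HOL-Analysis.Convex" "HOL-Real_Asymp.Real_Asymp"
begin

text \<open>
  Let \<open>q\<close> be the bias and \<open>f = q - deg\<^sub>M x - deg\<^sub>M y\<close> the number of free edges in a turn with Maker's
  edge \<open>{x, y}\<close>. Bernoulli's inequality bounds the net increase \<open>I - U\<close> by
  \<open>pot {x, y} * p0 * (\<mu> - 1) * f / q\<close>, while each free edge \<open>e\<close> decreases the total by at least
  \<open>pot e * (\<mu> - 1) / (\<mu> * q)\<close>. Hence after a critical turn every unclaimed edge has potential at most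
  \<open>\<mu> * p0 / (1 - \<eta>)\<close> times that of Maker's edge. As long as no vertex grows by a factor \<open>1 + \<epsilon>\<close>, the
  Maker edges of the critical turns have geometrically decreasing potential, so all critical turns
  together cost at most \<open>O(\<mu> - 1) * pot u = o(pot u)\<close>, and \<open>c\<close> of them force \<open>u\<close> below
  \<open>(1 - \<gamma>) * pot u\<close>.

  A fraction \<open>\<eta>\<close> of every other decrease is a gain for Breaker. If \<open>u\<close> loses \<open>\<gamma> * pot u\<close>, this gain is
  at least \<open>\<eta> * \<gamma> * pot u\<close>. If instead \<open>u\<close> stays above \<open>(1 - \<gamma>) * pot u\<close> and some vertex grows by
  \<open>1 + \<epsilon>\<close>, the values \<open>p0 * (\<mu> - 1) * f / q\<close> of the turns add up to at least \<open>ln (1 + \<epsilon>)\<close>, and since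
  every free edge has potential at least \<open>(1 - \<gamma>) * pot u\<close>, the gain is again of order \<open>pot u\<close>.
\<close>

text \<open>Weighted AM-GM for \<open>a\<close> and \<open>1\<close> with weights \<open>x\<close>
  and \<open>1 - x\<close>. It serves on both sides of 1: base \<open>\<mu>\<close> bounds Maker's
  increases, base \<open>1 / \<mu>\<close> bounds Breaker's decreases.\<close>

lemma powr_le_linear:
  fixes a x :: real
  assumes "0 < a" "0 \<le> x" "x \<le> 1"
  shows "a powr x \<le> 1 + x * (a - 1)"
  using Youngs_inequality_0[of x "1 - x" a 1] assms by (simp add: algebra_simps)

subsection \<open>Degrees\<close>

lemma finite_K: "finite (K n)"
  unfolding K_def by (rule finite_imp_finite_nsets) simp

lemma K_iff: "e \<in> K n \<longleftrightarrow> (\<exists>x y. e = {x, y} \<and> x \<noteq> y \<and> x < n \<and> y < n)"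
  unfolding K_def nsets_def by (auto simp: card_2_iff)

lemma deg_mono: "finite B \<Longrightarrow> A \<subseteq> B \<Longrightarrow> deg A v \<le> deg B v"
  unfolding deg_def by (intro card_mono) auto

lemma deg_Un_disjoint:
  assumes "finite A" "finite B" "A \<inter> B = {}"
  shows "deg (A \<union> B) v = deg A v + deg B v"
proof -
  have "{e \<in> A \<union> B. v \<in> e} = {e \<in> A. v \<in> e} \<union> {e \<in> B. v \<in> e}" by auto
  then show ?thesis
    unfolding deg_def using assms by (simp add: card_Un_disjoint disjoint_iff)
qed

lemma deg_insert:
  assumes "finite A" "e \<notin> A"
  shows "deg (insert e A) v = deg A v + (if v \<in> e then 1 else 0)"
proof -
  have "deg {e} v = (if v \<in> e then 1 else 0)"
  proof (cases "v \<in> e")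
    case True
    then have "{e' \<in> {e}. v \<in> e'} = {e}" by auto
    with True show ?thesis by (simp add: deg_def)
  qed (simp add: deg_def)
  then show ?thesis using deg_Un_disjoint[of A "{e}" v] assms by simp
qed

lemma deg_K:
  assumes "v < n"
  shows "deg (K n) v = n - 1"
proof -
  have "{e \<in> K n. v \<in> e} = (\<lambda>x. {v, x}) ` ({..<n} - {v})"
    using assms by (auto simp: K_iff image_iff doubleton_eq_iff)
  moreover have "inj_on (\<lambda>x. {v, x}) ({..<n} - {v})"
    by (auto simp: inj_on_def doubleton_eq_iff)
  ultimately show ?thesis
    unfolding deg_def using assms by (simp add: card_image)
qed

text \<open>The unclaimed edges at \<open>v\<close> account for the rest of its degree
  \<open>n - 1\<close> in \<open>K n\<close>. This translates the degree condition in
  \<open>pot\<close> into unclaimed edges.\<close>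

lemma full_degree_iff:
  assumes "v < n" "M \<subseteq> K n" "B \<subseteq> K n" "M \<inter> B = {}"
  shows "deg M v + deg B v = n - 1 \<longleftrightarrow> (\<forall>e \<in> K n - (M \<union> B). v \<notin> e)"
proof -
  have fin: "finite M" "finite B"
    using assms finite_K finite_subset by blast+
  define R where "R = K n - (M \<union> B)"
  have "K n = (M \<union> B) \<union> R" using assms R_def by auto
  then have "n - 1 = deg M v + deg B v + deg R v"
    using deg_K[OF assms(1)] deg_Un_disjoint[of "M \<union> B" R v] deg_Un_disjoint[of M B v]
      fin assms(4) finite_K R_def by (simp add: Diff_disjoint inf_commute)
  moreover have "deg R v = 0 \<longleftrightarrow> (\<forall>e \<in> R. v \<notin> e)"
    unfolding deg_def R_def using finite_K by auto
  ultimately show ?thesis by (simp add: R_def)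
qed

lemma degree_sum_le:
  assumes "v < n" "M \<subseteq> K n" "B \<subseteq> K n" "M \<inter> B = {}"
  shows "deg M v + deg B v \<le> n - 1"
proof -
  have "finite M" "finite B"
    using assms finite_K finite_subset by blast+
  then have "deg M v + deg B v = deg (M \<union> B) v"
    using deg_Un_disjoint assms(4) by simp
  also have "\<dots> \<le> deg (K n) v" using assms by (intro deg_mono finite_K) auto
  finally show ?thesis using deg_K[OF assms(1)] by simp
qed

subsection \<open>Monotonicity of the potential\<close>

locale game_params =
  fixes \<beta> \<delta> :: real and n :: nat
  assumes bias_pos: "0 < bias \<beta> n"
    and mu_gt_1: "1 < mu \<beta> \<delta> n"
    and p0_pos: "0 < p0 \<beta> \<delta>"
    and p0_le_1: "p0 \<beta> \<delta> \<le> 1"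
begin

abbreviation "q \<equiv> real (bias \<beta> n)"
abbreviation "\<mu> \<equiv> mu \<beta> \<delta> n"
abbreviation "p \<equiv> p0 \<beta> \<delta>"
abbreviation "raw \<equiv> raw_pot \<beta> \<delta> n"
abbreviation "vpot \<equiv> pot \<beta> \<delta> n"
abbreviation "epot \<equiv> edge_pot \<beta> \<delta> n"

lemma raw_pos: "0 < raw M B v"
  using mu_gt_1 by (simp add: raw_pot_def)

lemma pot_nonneg: "0 \<le> vpot M B v"
  using raw_pos[of M B v] by (simp add: pot_def)

lemma pot_le_raw: "vpot M B v \<le> raw M B v"
  using raw_pos[of M B v] by (simp add: pot_def)

lemma raw_shift:
  "raw M' B' v = raw M B v * \<mu> powr ((danger \<beta> \<delta> n M' B' v - danger \<beta> \<delta> n M B v) / q)"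
  unfolding raw_pot_def powr_add[symmetric] by (simp add: diff_divide_distrib)

lemma raw_antimono:
  assumes "finite B'" "B \<subseteq> B'"
  shows "raw M B' v \<le> raw M B v"
  using deg_mono[OF assms, of v] mu_gt_1 bias_pos
  by (auto simp: raw_pot_def danger_def intro!: powr_mono divide_right_mono)

text \<open>Besides monotonicity of \<open>raw_pot\<close>, the jump to 0 has to be respected: the
  degree sum never exceeds \<open>n - 1\<close>, so a vertex without unclaimed edges stays at
  0.\<close>

lemma pot_antimono:
  assumes "v < n" "M \<subseteq> K n" "B' \<subseteq> K n" "M \<inter> B' = {}" "B \<subseteq> B'"
  shows "vpot M B' v \<le> vpot M B v"
proof (cases "deg M v + deg B v = n - 1")
  case True
  have "deg B v \<le> deg B' v"
    using assms finite_K finite_subset deg_mono by metis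
  with True degree_sum_le[OF assms(1-4)] have "deg M v + deg B' v = n - 1" by linarith
  then show ?thesis by (simp add: pot_def True)
next
  case False
  then have "vpot M B v = raw M B v" by (simp add: pot_def)
  moreover have "finite B'" using assms(3) finite_K finite_subset by blast
  ultimately show ?thesis
    using pot_le_raw[of M B' v] raw_antimono[of B' B M v] assms(5) by simp
qed

lemma pot_eq_raw:
  assumes "v < n" "M \<subseteq> K n" "B \<subseteq> K n" "M \<inter> B = {}" "e \<in> K n - (M \<union> B)" "v \<in> e"
  shows "vpot M B v = raw M B v"
  using full_degree_iff[OF assms(1-4)] assms(5,6) by (auto simp: pot_def)

lemma pot_eq_0_iff:
  assumes "v < n" "M \<subseteq> K n" "B \<subseteq> K n" "M \<inter> B = {}"
  shows "vpot M B v = 0 \<longleftrightarrow> (\<forall>e \<in> K n - (M \<union> B). v \<notin> e)"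
  using full_degree_iff[OF assms] raw_pos[of M B v] by (auto simp: pot_def)

lemma edge_pot_antimono:
  assumes "e \<in> K n" "M \<subseteq> K n" "B' \<subseteq> K n" "M \<inter> B' = {}" "B \<subseteq> B'"
  shows "epot M B' e \<le> epot M B e"
  unfolding edge_pot_def
  using assms by (intro sum_mono pot_antimono) (auto simp: K_iff)

lemma edge_pot_ge:
  assumes "e \<in> K n" "v \<in> e"
  shows "vpot M B v \<le> epot M B e"
  unfolding edge_pot_def
  using assms pot_nonneg by (intro member_le_sum) (auto simp: K_iff)

lemma edge_pot_pair: "x \<noteq> y \<Longrightarrow> epot M B {x, y} = vpot M B x + vpot M B y"
  by (simp add: edge_pot_def)

text \<open>The edge lowers the danger of each endpoint by 1 and so multiplies
  \<open>raw_pot\<close> by \<open>\<mu> powr (- (1 / q))\<close>, to which Bernoulli's inequality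
  with base \<open>1 / \<mu>\<close> applies. Finally \<open>pot\<close> is at most
  \<open>raw_pot\<close>.\<close>

lemma single_edge_decrease:
  assumes "e \<in> K n" "finite B" "e \<notin> B"
  shows "epot M B e * ((\<mu> - 1) / (\<mu> * q)) \<le> (\<Sum>w<n. raw M B w - raw M (insert e B) w)"
proof -
  have "\<mu> powr (- (1 / q)) = (1 / \<mu>) powr (1 / q)"
    using mu_gt_1 by (simp add: powr_minus_divide powr_divide)
  also have "\<dots> \<le> 1 + (1 / q) * (1 / \<mu> - 1)"
    using mu_gt_1 bias_pos by (intro powr_le_linear) auto
  also have "\<dots> = 1 - (\<mu> - 1) / (\<mu> * q)"
    using mu_gt_1 bias_pos by (simp add: field_simps)
  finally have step: "\<mu> powr (- (1 / q)) \<le> 1 - (\<mu> - 1) / (\<mu> * q)" .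
  have vertex: "vpot M B w * ((\<mu> - 1) / (\<mu> * q)) \<le> raw M B w - raw M (insert e B) w"
    if "w \<in> e" for w
  proof -
    have "raw M (insert e B) w = raw M B w * \<mu> powr (- (1 / q))"
      using raw_shift[of M "insert e B" w M B] deg_insert[OF assms(2,3), of w] that
      by (simp add: danger_def)
    also have "\<dots> \<le> raw M B w * (1 - (\<mu> - 1) / (\<mu> * q))"
      using step raw_pos[of M B w] by (intro mult_left_mono) auto
    finally have "raw M B w * ((\<mu> - 1) / (\<mu> * q)) \<le> raw M B w - raw M (insert e B) w"
      by (simp add: algebra_simps)
    moreover have "vpot M B w * ((\<mu> - 1) / (\<mu> * q)) \<le> raw M B w * ((\<mu> - 1) / (\<mu> * q))"
      using pot_le_raw[of M B w] mu_gt_1 by (intro mult_right_mono) auto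
    ultimately show ?thesis by linarith
  qed
  have "epot M B e * ((\<mu> - 1) / (\<mu> * q)) \<le> (\<Sum>w\<in>e. raw M B w - raw M (insert e B) w)"
    unfolding edge_pot_def sum_distrib_right by (intro sum_mono vertex)
  also have "\<dots> \<le> (\<Sum>w<n. raw M B w - raw M (insert e B) w)"
    using assms raw_antimono[of "insert e B" B M] by (intro sum_mono2) (auto simp: K_iff)
  finally show ?thesis .
qed

end

subsection \<open>A single turn\<close>

locale breaker_turn = game_params +
  fixes M B :: "edge set" and a :: turn
  assumes legal: "legal_turn n (bias \<beta> n) M B a"
    and strategy: "strategy_turn \<beta> \<delta> n M B a"
    and no_isolation: "\<not> isolation n M B a"
    and M_subset: "M \<subseteq> K n"
    and B_subset: "B \<subseteq> K n"
    and disjoint: "M \<inter> B = {}"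
begin

abbreviation "M' \<equiv> insert (maker_edge a) M"
abbreviation "C \<equiv> closing_edges a"
abbreviation "B' \<equiv> B \<union> breaker_edges a"
abbreviation "budget \<equiv> q - (\<Sum>w\<in>maker_edge a. real (deg M w))"

definition "gain w = raw M' B w - raw M B w"
definition "head_loss w = raw M' B w - raw M' (B \<union> closing a w) w"
definition "free_loss w = raw M' (B \<union> C) w - raw M' B' w"
text \<open>The positive part of \<open>gain w - head_loss w\<close>: what the closing edges with
  head \<open>w\<close> leave of Maker's increase.\<close>

definition "net_gain w = gain w - min (gain w) (head_loss w)"

lemma maker_edge_unclaimed: "maker_edge a \<in> K n - (M \<union> B)"
  and breaker_edges_subset: "breaker_edges a \<subseteq> K n - (M' \<union> B)"
  and card_breaker_edges: "card (breaker_edges a) = min (bias \<beta> n) (card (K n - (M' \<union> B)))"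
  using legal by (auto simp: legal_turn_def Let_def)

lemma after_turn:
  shows "M' \<subseteq> K n" "B' \<subseteq> K n" "M' \<inter> B' = {}" "finite M'" "finite B'" "finite B" "finite M"
proof -
  show M': "M' \<subseteq> K n" using maker_edge_unclaimed M_subset by blast
  show B': "B' \<subseteq> K n" using breaker_edges_subset B_subset by blast
  show "M' \<inter> B' = {}"
    using maker_edge_unclaimed breaker_edges_subset disjoint by blast
  show "finite M'" by (rule finite_subset[OF M' finite_K])
  show "finite B'" by (rule finite_subset[OF B' finite_K])
  show "finite B" by (rule finite_subset[OF B_subset finite_K])
  show "finite M" by (rule finite_subset[OF M_subset finite_K])
qed

lemma maker_edge_cases:
  obtains u v where "maker_edge a = {u, v}" "u \<noteq> v" "u < n" "v < n"
  using maker_edge_unclaimed by (auto simp: K_iff)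

section \<open>Numbers of closing and free edges\<close>

lemma part1_closing: "maker_edge a = {u, v} \<Longrightarrow> part1 n M B u v (closing a u)"
  and part2_free: "part2 \<beta> \<delta> n M' (B \<union> C) (free a)"
  and closing_empty: "w \<notin> maker_edge a \<Longrightarrow> closing a w = {}"
  using strategy no_isolation by (auto simp: strategy_turn_def)

lemma closing_facts:
  assumes "maker_edge a = {u, v}"
  shows "card (closing a u) = deg M v"
    and "e \<in> closing a u \<Longrightarrow> u \<in> e \<and> e \<in> K n - (M' \<union> B)"
    and "finite (closing a u)"
proof -
  have "closing a u \<subseteq> available n M B u v"
    using part1_closing[OF assms] by (simp add: part1_def)
  then have *: "e \<in> closing a u \<Longrightarrow> u \<in> e \<and> e \<in> K n - (M' \<union> B)" for e
    by (auto simp: available_def assms)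
  show "card (closing a u) = deg M v"
    using part1_closing[OF assms] by (simp add: part1_def)
  show "e \<in> closing a u \<Longrightarrow> u \<in> e \<and> e \<in> K n - (M' \<union> B)" by (rule *)
  show "finite (closing a u)"
    using * finite_K[of n] by (meson Diff_iff finite_subset subsetI)
qed

lemma closing_edges_eq:
  assumes "maker_edge a = {u, v}"
  shows "C = closing a u \<union> closing a v"
proof -
  have "w = u \<or> w = v" if "e \<in> closing a w" for e w
    using closing_empty[of w] that assms by auto
  then show ?thesis unfolding closing_edges_def by blast
qed

text \<open>An edge in both closing sets would contain \<open>u\<close> and \<open>v\<close> and
  thus be Maker's edge, which is already taken; so the two counts add up.\<close>

lemma card_closing_edges:
  assumes "maker_edge a = {u, v}" "u \<noteq> v"
  shows "card C = deg M u + deg M v"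
proof -
  have vu: "maker_edge a = {v, u}" using assms by auto
  have "closing a u \<inter> closing a v = {}"
  proof (rule ccontr)
    assume "closing a u \<inter> closing a v \<noteq> {}"
    then obtain e where e: "e \<in> closing a u" "e \<in> closing a v" by auto
    have "u \<in> e" "v \<in> e" "e \<in> K n" "e \<noteq> maker_edge a"
      using closing_facts(2)[OF assms(1) e(1)] closing_facts(2)[OF vu e(2)] by auto
    then show False using assms by (auto simp: K_iff)
  qed
  then show ?thesis
    unfolding closing_edges_eq[OF assms(1)]
    using closing_facts[OF assms(1)] closing_facts[OF vu] by (simp add: card_Un_disjoint)
qed

lemma free_edge:
  assumes "i < length (free a)"
  shows "free a ! i \<in> K n - (M' \<union> (B \<union> C \<union> set (take i (free a))))"
    and "e \<in> K n - (M' \<union> (B \<union> C \<union> set (take i (free a)))) \<Longrightarrow>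
      epot M' (B \<union> C \<union> set (take i (free a))) e
        \<le> epot M' (B \<union> C \<union> set (take i (free a))) (free a ! i)"
  using part2_free assms unfolding part2_def Let_def by blast+

lemma distinct_free: "distinct (free a)"
proof -
  have less: "free a ! j \<noteq> free a ! i" if "j < i" "i < length (free a)" for i j
  proof -
    have "take i (free a) ! j \<in> set (take i (free a))"
      using that by (intro nth_mem) simp
    then have "free a ! j \<in> set (take i (free a))" using that(1) by simp
    then show ?thesis using free_edge(1)[OF that(2)] by (metis DiffD2 UnCI)
  qed
  then show ?thesis
    unfolding distinct_conv_nth by (metis linorder_neqE_nat)
qed

lemma card_breaker_edges_split:
  assumes "maker_edge a = {u, v}" "u \<noteq> v"
  shows "card (breaker_edges a) = deg M u + deg M v + length (free a)"
proof -
  have "C \<inter> set (free a) = {}"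
    using free_edge(1) by (fastforce simp: in_set_conv_nth)
  moreover have "finite C"
    using after_turn(5) by (simp add: breaker_edges_def)
  ultimately show ?thesis
    using card_closing_edges[OF assms] distinct_card[OF distinct_free]
    by (simp add: breaker_edges_def card_Un_disjoint)
qed

lemma sum_maker_edge:
  assumes "maker_edge a = {u, v}" "u \<noteq> v"
  shows "(\<Sum>w\<in>maker_edge a. real (deg M w)) = real (deg M u) + real (deg M v)"
  using assms by simp

text \<open>The closing edges alone number \<open>deg M u + deg M v\<close>, and the rules cap
  Breaker's edges at the bias.\<close>

lemma budget_nonneg: "0 \<le> budget"
proof -
  obtain u v where uv: "maker_edge a = {u, v}" "u \<noteq> v" by (rule maker_edge_cases)
  have "deg M u + deg M v \<le> bias \<beta> n"
    using card_breaker_edges card_breaker_edges_split[OF uv] by linarith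
  then show ?thesis unfolding sum_maker_edge[OF uv] by linarith
qed

lemma budget_le: "budget \<le> q"
  by (simp add: sum_nonneg)

text \<open>The surviving edge \<open>e\<close> shows that the board did not run out, so Breaker
  claimed exactly \<open>bias \<beta> n\<close> edges.\<close>

lemma length_free:
  assumes "e \<in> K n - (M' \<union> B')"
  shows "real (length (free a)) = budget"
proof -
  obtain u v where uv: "maker_edge a = {u, v}" "u \<noteq> v" by (rule maker_edge_cases)
  have "breaker_edges a \<subset> K n - (M' \<union> B)"
    using breaker_edges_subset assms by auto
  then have "card (breaker_edges a) < card (K n - (M' \<union> B))"
    using finite_K by (intro psubset_card_mono) auto
  then have "card (breaker_edges a) = bias \<beta> n"
    using card_breaker_edges by linarith
  then show ?thesis
    unfolding sum_maker_edge[OF uv] using card_breaker_edges_split[OF uv] by linarith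
qed

section \<open>Maker's net gain in one turn\<close>

lemma net_gain_nonneg: "0 \<le> net_gain w"
  by (simp add: net_gain_def)

lemma net_gain_off_edge: "w \<notin> maker_edge a \<Longrightarrow> net_gain w = 0"
proof -
  assume w: "w \<notin> maker_edge a"
  have "deg M' w = deg M w"
    using deg_insert[of M "maker_edge a" w] w after_turn maker_edge_unclaimed by simp
  then have "gain w = 0"
    by (simp add: gain_def raw_pot_def danger_def deg_star_def)
  moreover have "head_loss w = 0"
    using closing_empty[OF w] by (simp add: head_loss_def)
  ultimately show ?thesis by (simp add: net_gain_def)
qed

text \<open>Breaker's closing edges at \<open>u\<close> lower the danger of \<open>u\<close> by \<open>deg M v\<close>, and \<open>p \<le> 1\<close>; hence
  the danger of \<open>u\<close> rises by at most \<open>p\<close> times the number of free edges.\<close>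

lemma net_gain_endpoint:
  assumes "w \<in> maker_edge a"
  shows "net_gain w \<le> vpot M B w * (p * (\<mu> - 1) * budget / q)"
proof -
  obtain v where edge: "maker_edge a = {w, v}" and "w \<noteq> v" and "w < n"
  proof -
    obtain u v where "maker_edge a = {u, v}" "u \<noteq> v" "u < n" "v < n" by (rule maker_edge_cases)
    then show ?thesis using that[of u] that[of v] assms by (auto simp: insert_commute)
  qed
  define m where "m = real (deg M w)"
  define m' where "m' = real (deg M v)"
  have budget: "budget = q - m - m'"
    using sum_maker_edge[OF edge \<open>w \<noteq> v\<close>] by (simp add: m_def m'_def)
  have "deg M' w = deg M w + 1"
    using deg_insert[of M "maker_edge a" w] assms after_turn maker_edge_unclaimed by simp
  moreover have "deg (B \<union> closing a w) w = deg B w + deg M v"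
  proof -
    have "{e \<in> closing a w. w \<in> e} = closing a w"
      using closing_facts(2)[OF edge] by auto
    then have "deg (closing a w) w = deg M v"
      using closing_facts(1)[OF edge] by (simp add: deg_def)
    moreover have "B \<inter> closing a w = {}"
      using closing_facts(2)[OF edge] by auto
    ultimately show ?thesis
      using deg_Un_disjoint[of B "closing a w" w] after_turn closing_facts(3)[OF edge] by simp
  qed
  ultimately have "danger \<beta> \<delta> n M' (B \<union> closing a w) w - danger \<beta> \<delta> n M B w
      = p * ((m + 1) * (q - (m + 1) / 2) - m * (q - m / 2)) - m'"
    unfolding danger_def deg_star_def Let_def m_def m'_def right_diff_distrib[of p]
    by (simp add: add.commute)
  \<comment> \<open>The increment of \<open>m * (q - m / 2)\<close> from \<open>m\<close> to
    \<open>m + 1\<close> is \<open>q - m - 1 / 2\<close>.\<close>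
  also have "\<dots> = p * (q - m - 1 / 2) - m'"
    by (simp add: field_simps)
  also have "\<dots> \<le> p * budget"
  proof -
    have "p * m' \<le> m'" using p0_le_1 p0_pos by (simp add: m'_def mult_left_le_one_le)
    then show ?thesis using p0_pos by (simp add: budget algebra_simps)
  qed
  finally have "\<mu> powr ((danger \<beta> \<delta> n M' (B \<union> closing a w) w - danger \<beta> \<delta> n M B w) / q)
      \<le> \<mu> powr (p * budget / q)"
    using mu_gt_1 bias_pos by (intro powr_mono divide_right_mono) auto
  also have "\<dots> \<le> 1 + (p * budget / q) * (\<mu> - 1)"
  proof (rule powr_le_linear)
    have "p * budget \<le> 1 * q"
      using p0_pos p0_le_1 budget_nonneg budget_le by (intro mult_mono) auto
    then show "p * budget / q \<le> 1" using bias_pos by simp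
    show "0 \<le> p * budget / q"
      using p0_pos budget_nonneg by (intro divide_nonneg_nonneg mult_nonneg_nonneg) auto
  qed (use mu_gt_1 in simp)
  finally have "raw M' (B \<union> closing a w) w \<le> raw M B w * (1 + p * budget / q * (\<mu> - 1))"
    unfolding raw_shift[of M' "B \<union> closing a w" w M B]
    using raw_pos[of M B w] by (intro mult_left_mono) auto
  then have "gain w - head_loss w \<le> raw M B w * (p * (\<mu> - 1) * budget / q)"
    by (simp add: gain_def head_loss_def algebra_simps)
  moreover have "0 \<le> raw M B w * (p * (\<mu> - 1) * budget / q)"
    using raw_pos[of M B w] p0_pos mu_gt_1 budget_nonneg
    by (intro divide_nonneg_nonneg mult_nonneg_nonneg) auto
  moreover have "vpot M B w = raw M B w"
    by (rule pot_eq_raw[OF \<open>w < n\<close> M_subset B_subset disjoint maker_edge_unclaimed assms])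
  ultimately show ?thesis by (simp add: net_gain_def)
qed

lemma net_gain_le:
  "net_gain w \<le> vpot M B w * (p * (\<mu> - 1) * budget / q)"
proof (cases "w \<in> maker_edge a")
  case False
  have "0 \<le> vpot M B w * (p * (\<mu> - 1) * budget / q)"
    using pot_nonneg[of M B w] p0_pos mu_gt_1 budget_nonneg
    by (intro divide_nonneg_nonneg mult_nonneg_nonneg) auto
  with False show ?thesis by (simp add: net_gain_off_edge)
qed (rule net_gain_endpoint)

lemma sum_net_gain_le:
  "(\<Sum>w<n. net_gain w) \<le> epot M B (maker_edge a) * (p * (\<mu> - 1) * budget / q)"
proof -
  have "(\<Sum>w<n. net_gain w) = (\<Sum>w\<in>maker_edge a. net_gain w)"
    using maker_edge_unclaimed
    by (intro sum.mono_neutral_right) (auto simp: K_iff net_gain_off_edge)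
  also have "\<dots> \<le> epot M B (maker_edge a) * (p * (\<mu> - 1) * budget / q)"
    unfolding edge_pot_def sum_distrib_right by (intro sum_mono net_gain_endpoint)
  finally show ?thesis .
qed

section \<open>Losses by free edges in one turn\<close>

lemma free_loss_nonneg: "0 \<le> free_loss w"
  unfolding free_loss_def
  using raw_antimono[OF after_turn(5), of "B \<union> C" M' w] by (auto simp: breaker_edges_def)

text \<open>Losses of \<open>w\<close> as a tail of closing edges and a final drop to 0 only enlarge
  the right side. A vertex already at 0 has no unclaimed edge, so the turn does not change its
  degrees.\<close>

lemma free_loss_le_potential_drop:
  assumes "w < n"
  shows "free_loss w \<le> vpot M B w - vpot M' B' w + net_gain w"
proof -
  have "raw M' (B \<union> C) w \<le> raw M' (B \<union> closing a w) w"
    using after_turn(5) by (intro raw_antimono) (auto simp: breaker_edges_def closing_edges_def)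
  then have "free_loss w \<le> raw M B w - raw M' B' w + net_gain w"
    by (simp add: free_loss_def net_gain_def gain_def head_loss_def)
  moreover have "raw M B w - raw M' B' w \<le> vpot M B w - vpot M' B' w"
  proof (cases "vpot M B w = 0")
    case True
    then have untouched: "w \<notin> e" if "e \<in> K n - (M \<union> B)" for e
      using pot_eq_0_iff[OF assms M_subset B_subset disjoint] that by blast
    have "{e \<in> M'. w \<in> e} = {e \<in> M. w \<in> e}" "{e \<in> B'. w \<in> e} = {e \<in> B. w \<in> e}"
      using untouched maker_edge_unclaimed breaker_edges_subset by blast+
    then have "deg M' w = deg M w" "deg B' w = deg B w"
      by (simp_all add: deg_def)
    then show ?thesis
      by (simp add: pot_def raw_pot_def danger_def deg_star_def)
  next
    case False
    then have "vpot M B w = raw M B w" by (auto simp: pot_def)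
    then show ?thesis using pot_le_raw[of M' B' w] by simp
  qed
  ultimately show ?thesis by linarith
qed

text \<open>The surviving edge \<open>e\<close> was available for every free choice. By greediness
  each free edge had at least the potential that \<open>e\<close> had at that moment, hence at least
  its final potential. The single losses telescope.\<close>

lemma sum_free_loss_ge:
  assumes e: "e \<in> K n - (M' \<union> B')"
  shows "budget * epot M' B' e * ((\<mu> - 1) / (\<mu> * q)) \<le> (\<Sum>w<n. free_loss w)"
proof -
  define c where "c = epot M' B' e * ((\<mu> - 1) / (\<mu> * q))"
  let ?B = "\<lambda>i. B \<union> C \<union> set (take i (free a))"
  have "real i * c \<le> (\<Sum>w<n. raw M' (B \<union> C) w - raw M' (?B i) w)" if "i \<le> length (free a)" for i
    using that
  proof (induction i)
    case (Suc i)
    then have i: "i < length (free a)" by simp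
    have sub: "?B i \<subseteq> B'"
      using set_take_subset[of i "free a"] by (auto simp: breaker_edges_def)
    have "epot M' B' e \<le> epot M' (?B i) e"
      using e after_turn sub by (intro edge_pot_antimono) auto
    also have "\<dots> \<le> epot M' (?B i) (free a ! i)"
      using e sub by (intro free_edge(2)[OF i]) auto
    finally have "c \<le> epot M' (?B i) (free a ! i) * ((\<mu> - 1) / (\<mu> * q))"
      unfolding c_def using mu_gt_1 by (intro mult_right_mono) auto
    also have "\<dots> \<le> (\<Sum>w<n. raw M' (?B i) w - raw M' (insert (free a ! i) (?B i)) w)"
      using free_edge(1)[OF i] finite_subset[OF sub after_turn(5)]
      by (intro single_edge_decrease) auto
    also have "insert (free a ! i) (?B i) = ?B (Suc i)"
      by (simp add: take_Suc_conv_app_nth[OF i])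
    finally have "c \<le> (\<Sum>w<n. raw M' (?B i) w - raw M' (?B (Suc i)) w)" .
    with Suc.IH Suc.prems show ?case
      by (simp add: sum_subtractf algebra_simps)
  qed simp
  from this[of "length (free a)"] have "budget * c \<le> (\<Sum>w<n. free_loss w)"
    by (simp add: length_free[OF e] free_loss_def breaker_edges_def Un_assoc)
  then show ?thesis by (simp only: c_def mult.assoc)
qed

text \<open>Since the free edges are chosen greedily, a free edge of small potential bounds the potential
  of every edge that is left.\<close>

lemma critical_edge_pot_le:
  assumes crit: "(1 - \<eta>) * (\<Sum>w<n. free_loss w) < (\<Sum>w<n. net_gain w)"
    and "\<eta> < 1" and e: "e \<in> K n - (M' \<union> B')"
  shows "epot M' B' e \<le> \<mu> * p / (1 - \<eta>) * epot M B (maker_edge a)"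
proof -
  \<comment> \<open>In a critical turn \<open>budget\<close> is not 0, since otherwise
    \<open>sum_net_gain_le\<close> would make the right side of \<open>crit\<close> at most 0. This
    permits cancelling the common factor.\<close>
  have pos: "0 < budget * ((\<mu> - 1) / q)"
  proof -
    have "0 \<le> (1 - \<eta>) * (\<Sum>w<n. free_loss w)"
      using \<open>\<eta> < 1\<close> by (intro mult_nonneg_nonneg sum_nonneg free_loss_nonneg) auto
    then have "budget \<noteq> 0" using crit sum_net_gain_le by auto
    then show ?thesis using budget_nonneg mu_gt_1 bias_pos by simp
  qed
  have "((1 - \<eta>) / \<mu> * epot M' B' e) * (budget * ((\<mu> - 1) / q))
      = (1 - \<eta>) * (budget * epot M' B' e * ((\<mu> - 1) / (\<mu> * q)))"
    by (simp only: times_divide_eq_right times_divide_eq_left divide_divide_eq_left mult_ac)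
  also have "\<dots> \<le> (1 - \<eta>) * (\<Sum>w<n. free_loss w)"
    using \<open>\<eta> < 1\<close> by (intro mult_left_mono sum_free_loss_ge[OF e]) simp
  also have "\<dots> \<le> (\<Sum>w<n. net_gain w)" using crit by (rule less_imp_le)
  also have "\<dots> \<le> epot M B (maker_edge a) * (p * (\<mu> - 1) * budget / q)"
    by (rule sum_net_gain_le)
  also have "\<dots> = (p * epot M B (maker_edge a)) * (budget * ((\<mu> - 1) / q))"
    by (simp only: times_divide_eq_right times_divide_eq_left mult_ac)
  finally have "((1 - \<eta>) / \<mu> * epot M' B' e) * (budget * ((\<mu> - 1) / q))
      \<le> (p * epot M B (maker_edge a)) * (budget * ((\<mu> - 1) / q))" .
  then have "(1 - \<eta>) / \<mu> * epot M' B' e \<le> p * epot M B (maker_edge a)"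
    using pos by (rule mult_right_le_imp_le)
  then show ?thesis using mu_gt_1 \<open>\<eta> < 1\<close> by (simp add: field_simps)
qed

end

subsection \<open>The course of the game\<close>

locale strategic_game = game_params +
  fixes g :: "turn list"
  assumes strategy_game: "strategy_game \<beta> \<delta> n g"
    and no_isolation_turn: "\<And>t. t \<in> {1..length g} \<Longrightarrow> \<not> isolation_turn n g t"
begin

abbreviation "Mg \<equiv> maker_graph g"
abbreviation "Bg \<equiv> breaker_graph g"
abbreviation "P \<equiv> pot_at \<beta> \<delta> n g"
abbreviation "E \<equiv> \<lambda>t. epot (Mg t) (Bg t)"
abbreviation "tpot \<equiv> POT \<beta> \<delta> n g"
abbreviation "unclaimed t \<equiv> K n - (Mg t \<union> Bg t)"
abbreviation "m_edge t \<equiv> maker_edge (turn_at g t)"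
abbreviation "loss \<equiv> decr_free \<beta> \<delta> n g"
abbreviation "crit \<eta> \<equiv> critical \<beta> \<delta> n \<eta> g"

definition "net t w = incr \<beta> \<delta> n g t w - U \<beta> \<delta> n g t w"
text \<open>This collects the effects of Breaker's edges that are not offset against Maker's
  increase: free edges, closing edges with tail \<open>w\<close>, surplus of head edges, and drops
  to 0.\<close>

definition "fall t w = P (t - 1) w - P t w + net t w"
text \<open>A bound for the relative growth of a vertex in turn \<open>t\<close>, proportional to
  the number of free edges granted by the strategy.\<close>

definition "rate t = p * (\<mu> - 1) * (q - (\<Sum>w\<in>m_edge t. real (deg (Mg (t - 1)) w))) / q"

lemma maker_graph_step: "1 \<le> t \<Longrightarrow> Mg t = insert (m_edge t) (Mg (t - 1))"
  by (cases t) (auto simp: maker_graph_def atLeastAtMostSuc_conv)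

lemma breaker_graph_step: "1 \<le> t \<Longrightarrow> Bg t = Bg (t - 1) \<union> breaker_edges (turn_at g t)"
  by (cases t) (auto simp: breaker_graph_def atLeastAtMostSuc_conv)

lemma graphs_subset_disjoint:
  "t \<le> length g \<Longrightarrow> Mg t \<subseteq> K n \<and> Bg t \<subseteq> K n \<and> Mg t \<inter> Bg t = {}"
proof (induction t)
  case 0
  show ?case by (simp add: maker_graph_def breaker_graph_def)
next
  case (Suc t)
  then have "Suc t \<in> {1..length g}" by simp
  then have "legal_turn n (bias \<beta> n) (Mg t) (Bg t) (turn_at g (Suc t))"
    using strategy_game unfolding strategy_game_def by (metis diff_Suc_1)
  then have "m_edge (Suc t) \<in> K n - (Mg t \<union> Bg t)"
    "breaker_edges (turn_at g (Suc t)) \<subseteq> K n - (insert (m_edge (Suc t)) (Mg t) \<union> Bg t)"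
    by (auto simp: legal_turn_def Let_def)
  then show ?case
    using Suc maker_graph_step[of "Suc t"] breaker_graph_step[of "Suc t"] by auto
qed

lemma breaker_turn:
  assumes "t \<in> {1..length g}"
  shows "breaker_turn \<beta> \<delta> n (Mg (t - 1)) (Bg (t - 1)) (turn_at g t)"
proof -
  have "t - 1 \<le> length g" using assms by auto
  with graphs_subset_disjoint[OF this] show ?thesis
    using assms strategy_game no_isolation_turn[OF assms]
    by unfold_locales (auto simp: strategy_game_def isolation_turn_def)
qed

context
  fixes t :: nat
  assumes t: "t \<in> {1..length g}"
begin

interpretation T: breaker_turn \<beta> \<delta> n "Mg (t - 1)" "Bg (t - 1)" "turn_at g t"
  by (rule breaker_turn[OF t])

lemma graphs_after: "insert (m_edge t) (Mg (t - 1)) = Mg t"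
    "Bg (t - 1) \<union> breaker_edges (turn_at g t) = Bg t"
  using t maker_graph_step[of t, symmetric] breaker_graph_step[of t, symmetric] by simp_all

lemma net_gain_eq: "T.net_gain w = net t w"
  unfolding T.net_gain_def T.gain_def T.head_loss_def net_def incr_def U_def decr_head_def
    graphs_after ..

lemma free_loss_eq: "T.free_loss w = loss t w"
  unfolding T.free_loss_def decr_free_def graphs_after ..

lemma m_edge_unclaimed: "m_edge t \<in> unclaimed (t - 1)"
  by (rule T.maker_edge_unclaimed)

lemma rate_nonneg: "0 \<le> rate t"
  unfolding rate_def using p0_pos mu_gt_1 T.budget_nonneg
  by (intro divide_nonneg_nonneg mult_nonneg_nonneg) auto

lemma rate_le: "rate t \<le> p * (\<mu> - 1)"
proof -
  have "p * (\<mu> - 1) * T.budget \<le> p * (\<mu> - 1) * q"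
    using p0_pos mu_gt_1 T.budget_le by (intro mult_left_mono) auto
  then show ?thesis unfolding rate_def using bias_pos by (simp add: pos_divide_le_eq)
qed

lemma net_nonneg: "0 \<le> net t w"
  using T.net_gain_nonneg[of w] unfolding net_gain_eq .

lemma net_le: "net t w \<le> P (t - 1) w * rate t"
  using T.net_gain_le[of w] unfolding net_gain_eq rate_def pot_at_def .

lemma sum_net_le: "(\<Sum>w<n. net t w) \<le> E (t - 1) (m_edge t) * rate t"
  using T.sum_net_gain_le unfolding net_gain_eq rate_def .

lemma loss_nonneg: "0 \<le> loss t w"
  using T.free_loss_nonneg[of w] unfolding free_loss_eq .

lemma loss_le_fall: "w < n \<Longrightarrow> loss t w \<le> fall t w"
  using T.free_loss_le_potential_drop[of w]
  unfolding free_loss_eq net_gain_eq fall_def pot_at_def graphs_after .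

lemma fall_nonneg: "w < n \<Longrightarrow> 0 \<le> fall t w"
  using loss_nonneg[of w] loss_le_fall[of w] by linarith

text \<open>The \<open>rate t\<close> that limits growth also bounds the loss from below: vertices
  can grow fast only if Breaker has many free edges.\<close>

lemma sum_loss_ge:
  assumes "e \<in> unclaimed t"
  shows "rate t * (E t e / (\<mu> * p)) \<le> (\<Sum>w<n. loss t w)"
proof -
  have "rate t * (E t e / (\<mu> * p)) = T.budget * E t e * ((\<mu> - 1) / (\<mu> * q))"
    unfolding rate_def using p0_pos by (simp add: mult_ac)
  also have "\<dots> \<le> (\<Sum>w<n. loss t w)"
    using T.sum_free_loss_ge[of e] assms unfolding free_loss_eq graphs_after by blast
  finally show ?thesis .
qed

lemma critical_iff: "crit \<eta> t \<longleftrightarrow> (1 - \<eta>) * (\<Sum>w<n. loss t w) < (\<Sum>w<n. net t w)"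
  by (simp add: critical_def net_def sum_subtractf)

lemma critical_E_le:
  assumes "crit \<eta> t" "\<eta> < 1" "e \<in> unclaimed t"
  shows "E t e \<le> \<mu> * p / (1 - \<eta>) * E (t - 1) (m_edge t)"
  by (rule T.critical_edge_pot_le[unfolded free_loss_eq net_gain_eq graphs_after,
        OF assms(1)[unfolded critical_iff] assms(2,3)])

text \<open>The exponential form lets the rates of successive turns be added.\<close>

lemma pot_growth:
  assumes "w < n"
  shows "P t w \<le> P (t - 1) w * exp (rate t)"
proof -
  have "P t w \<le> P (t - 1) w * (1 + rate t)"
    using net_le[of w] fall_nonneg[OF assms] by (simp add: fall_def algebra_simps)
  also have "\<dots> \<le> P (t - 1) w * exp (rate t)"
    using pot_nonneg by (intro mult_left_mono exp_ge_add_one_self) (simp add: pot_at_def)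
  finally show ?thesis .
qed

text \<open>In a non-critical turn \<open>net\<close> is at most \<open>1 - \<eta>\<close> times the
  free losses, hence times the falls, so a fraction \<open>\<eta>\<close> of the falls remains. In a
  critical turn the whole net gain is charged separately.\<close>

lemma total_decrease:
  assumes "0 \<le> \<eta>" "\<eta> \<le> 1"
  shows "\<eta> * (\<Sum>w<n. fall t w) - (if crit \<eta> t then \<Sum>w<n. net t w else 0) \<le> tpot (t - 1) - tpot t"
proof -
  have tpot: "tpot (t - 1) - tpot t = (\<Sum>w<n. fall t w) - (\<Sum>w<n. net t w)"
    by (simp add: POT_def fall_def sum.distrib sum_subtractf)
  have fall: "0 \<le> (\<Sum>w<n. fall t w)"
    by (intro sum_nonneg fall_nonneg) simp
  have "(1 - \<eta>) * (\<Sum>w<n. loss t w) \<le> (1 - \<eta>) * (\<Sum>w<n. fall t w)"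
    using assms by (intro mult_left_mono sum_mono loss_le_fall) auto
  moreover have "\<eta> * (\<Sum>w<n. fall t w) \<le> 1 * (\<Sum>w<n. fall t w)"
    using assms fall by (intro mult_right_mono) auto
  ultimately show ?thesis
    unfolding tpot critical_iff by (auto simp: algebra_simps)
qed

end

section \<open>Potentials and unclaimed edges over several turns\<close>

lemma P_nonneg: "0 \<le> P t w"
  using pot_nonneg by (simp add: pot_at_def)

lemma E_pair: "x \<noteq> y \<Longrightarrow> E t {x, y} = P t x + P t y"
  by (simp add: edge_pot_pair pot_at_def)

lemma pot_growth_interval:
  assumes "s \<le> t" "t \<le> length g" "w < n"
  shows "P t w \<le> P s w * exp (\<Sum>i\<in>{Suc s..t}. rate i)"
  using assms(1,2)
proof (induction t rule: dec_induct)
  case (step t)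
  have "P (Suc t) w \<le> P t w * exp (rate (Suc t))"
    using pot_growth[of "Suc t" w] step assms by simp
  also have "\<dots> \<le> P s w * exp (\<Sum>i\<in>{Suc s..t}. rate i) * exp (rate (Suc t))"
    using step by (intro mult_right_mono) auto
  finally show ?case
    using step by (simp add: exp_add atLeastAtMostSuc_conv add.commute mult_ac)
qed simp

lemma pot_stays_0:
  assumes "s \<le> t" "t \<le> length g" "w < n" "P s w = 0"
  shows "P t w = 0"
  using pot_growth_interval[OF assms(1-3)] P_nonneg[of t w] assms(4) by simp

lemma unclaimed_antimono:
  assumes "s \<le> t"
  shows "unclaimed t \<subseteq> unclaimed s"
proof -
  have "Mg s \<subseteq> Mg t" "Bg s \<subseteq> Bg t"
    unfolding maker_graph_def breaker_graph_def using assms by (intro UN_mono; simp)+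
  then show ?thesis by blast
qed

lemma unclaimed_edge_exists:
  assumes "w < n" "t \<le> length g" "P t w \<noteq> 0"
  obtains e where "e \<in> unclaimed t" "w \<in> e"
proof -
  have "\<not> (\<forall>e\<in>unclaimed t. w \<notin> e)"
    using pot_eq_0_iff[OF assms(1), of "Mg t" "Bg t"] graphs_subset_disjoint[OF assms(2)] assms(3)
    by (simp only: pot_at_def simp_thms)
  then show thesis using that by blast
qed

end

subsection \<open>From turn \<open>t0\<close> to the stopping turn\<close>

text \<open>\<open>T\<close> stands for the stopping turn. \<open>no_growth\<close> ends before
  \<open>T\<close>, because a vertex may reach the factor \<open>1 + \<epsilon>\<close> in turn
  \<open>T\<close> itself.\<close>

locale critical_phase = strategic_game +
  fixes \<eta> \<epsilon> :: real and t0 u v T :: nat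
  assumes eta_pos: "0 < \<eta>" and eta_less_1: "\<eta> < 1" and eps_pos: "0 < \<epsilon>"
    and ratio_less_1: "(1 + \<epsilon>) * (\<mu> * p) / (1 - \<eta>) < 1"
    and t0: "t0 \<in> {1..length g}" and t0_le_T: "t0 \<le> T" and T_le: "T \<le> length g"
    and total_increase: "tpot (t0 - 1) < tpot t0"
    and first_edge: "m_edge t0 = {u, v}"
    and label: "P (t0 - 1) v \<le> P (t0 - 1) u"
    and no_growth: "\<And>s t w. \<lbrakk>t0 \<le> s; s < t; t < T; w < n; 0 < P s w\<rbrakk> \<Longrightarrow> P t w < (1 + \<epsilon>) * P s w"
begin

text \<open>Each critical turn contributes \<open>\<mu> * p / (1 - \<eta>)\<close> by
  \<open>critical_E_le\<close>, and growth until the next one at most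
  \<open>1 + \<epsilon>\<close>.\<close>

definition "r = (1 + \<epsilon>) * (\<mu> * p) / (1 - \<eta>)"
text \<open>By the labelling of \<open>u\<close> and \<open>v\<close>, an upper bound for the
  potential of Maker's edge before turn \<open>t0\<close>.\<close>

abbreviation "G \<equiv> 2 * P (t0 - 1) u"
abbreviation "crit_turns t \<equiv> {s \<in> {t0..t}. crit \<eta> s}"

lemma r_less_1: "r < 1"
  using ratio_less_1 by (simp add: r_def)

lemma r_pos: "0 < r"
  unfolding r_def using eta_less_1 eps_pos mu_gt_1 p0_pos by (intro divide_pos_pos mult_pos_pos) auto

lemma u_less: "u < n"
  and u_neq_v: "u \<noteq> v"
  using m_edge_unclaimed[OF t0] first_edge by (auto simp: K_iff doubleton_eq_iff)

text \<open>A non-critical turn cannot raise the total potential, but turn \<open>t0\<close>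
  does.\<close>

lemma first_turn_critical: "crit \<eta> t0"
proof (rule ccontr)
  assume "\<not> crit \<eta> t0"
  moreover have "0 \<le> \<eta> * (\<Sum>w<n. fall t0 w)"
    using eta_pos fall_nonneg[OF t0] by (intro mult_nonneg_nonneg sum_nonneg) auto
  ultimately show False
    using total_decrease[OF t0, of \<eta>] eta_pos eta_less_1 total_increase by simp
qed

text \<open>As in \<open>t2\<close>, only vertices of positive potential are subject to
  \<open>growth\<close>; the others stay at 0. The case \<open>s = t\<close> is included for a
  witness turn \<open>s\<close> that is the current one.\<close>

lemma E_growth:
  assumes "t0 \<le> s" "s \<le> t" "t \<le> length g" "e \<in> K n"
    and growth: "\<And>w. \<lbrakk>s < t; w < n; 0 < P s w\<rbrakk> \<Longrightarrow> P t w < (1 + \<epsilon>) * P s w"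
  shows "E t e \<le> (1 + \<epsilon>) * E s e"
  unfolding edge_pot_def sum_distrib_left pot_at_def[symmetric]
proof (rule sum_mono)
  fix w assume "w \<in> e"
  then have "w < n" using assms(4) by (auto simp: K_iff)
  show "P t w \<le> (1 + \<epsilon>) * P s w"
  proof (cases "s = t \<or> P s w = 0")
    case True
    then show ?thesis
      using pot_stays_0[OF assms(2,3) \<open>w < n\<close>] P_nonneg[of s w] eps_pos
      by (auto simp: distrib_right)
  next
    case False
    then show ?thesis
      using growth[OF _ \<open>w < n\<close>] assms(2) P_nonneg[of s w] by fastforce
  qed
qed

text \<open>With \<open>k\<close> critical turns so far, the potential of every edge unclaimed after the last of them
  (turn \<open>s\<close>) is at most \<open>G * r ^ k / (1 + \<epsilon>)\<close>; by \<open>no_growth\<close> the factor \<open>1 + \<epsilon>\<close> is the most that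
  can be lost until the next critical turn.\<close>

lemma critical_turns_decay:
  assumes "t0 \<le> t" "t \<le> T"
  shows "(\<Sum>s\<in>crit_turns t. \<Sum>w<n. net s w) \<le> G * (p * (\<mu> - 1)) * (\<Sum>j<card (crit_turns t). r ^ j)
    \<and> (\<exists>s\<in>{t0..t}. \<forall>e\<in>unclaimed s. (1 + \<epsilon>) * E s e \<le> G * r ^ card (crit_turns t))"
  using assms
proof (induction t rule: dec_induct)
  \<comment> \<open>Turn \<open>t0\<close> is itself critical, so the count starts at 1, with
    witness \<open>t0\<close>.\<close>
  case base
  have turns: "crit_turns t0 = {t0}" using first_turn_critical by auto
  have E0: "E (t0 - 1) (m_edge t0) \<le> G"
    using label u_neq_v by (simp add: first_edge E_pair)
  have "(\<Sum>w<n. net t0 w) \<le> E (t0 - 1) (m_edge t0) * rate t0"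
    by (rule sum_net_le[OF t0])
  also have "\<dots> \<le> G * (p * (\<mu> - 1))"
    using E0 rate_le[OF t0] rate_nonneg[OF t0] P_nonneg[of "t0 - 1" u] by (intro mult_mono) auto
  finally have "(\<Sum>w<n. net t0 w) \<le> G * (p * (\<mu> - 1))" .
  moreover have "(1 + \<epsilon>) * E t0 e \<le> G * r" if "e \<in> unclaimed t0" for e
  proof -
    have "E t0 e \<le> \<mu> * p / (1 - \<eta>) * E (t0 - 1) (m_edge t0)"
      by (rule critical_E_le[OF t0 first_turn_critical eta_less_1 that])
    also have "\<dots> \<le> \<mu> * p / (1 - \<eta>) * G"
      using E0 mu_gt_1 p0_pos eta_less_1 by (intro mult_left_mono) auto
    finally have "(1 + \<epsilon>) * E t0 e \<le> (1 + \<epsilon>) * (\<mu> * p / (1 - \<eta>) * G)"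
      using eps_pos by (intro mult_left_mono) auto
    then show ?thesis by (simp add: r_def mult_ac)
  qed
  ultimately show ?case unfolding turns by simp
next
  case (step t)
  let ?k = "card (crit_turns t)"
  have t: "Suc t \<in> {1..length g}" using step T_le by simp
  obtain s where s: "s \<in> {t0..t}" and
    bound: "\<And>e. e \<in> unclaimed s \<Longrightarrow> (1 + \<epsilon>) * E s e \<le> G * r ^ ?k"
    using step by auto
  have IH: "(\<Sum>s\<in>crit_turns t. \<Sum>w<n. net s w) \<le> G * (p * (\<mu> - 1)) * (\<Sum>j<?k. r ^ j)"
    using step by simp
  show ?case
  proof (cases "crit \<eta> (Suc t)")
    case False
    then have "crit_turns (Suc t) = crit_turns t" by (auto simp: le_Suc_eq)
    then show ?thesis using IH s bound by (auto intro!: bexI[of _ s])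
  next
    case True
    have turns: "crit_turns (Suc t) = insert (Suc t) (crit_turns t)"
      using True step by (auto simp: le_Suc_eq)
    have fresh: "Suc t \<notin> crit_turns t" by simp
    have edge: "m_edge (Suc t) \<in> unclaimed t"
      using m_edge_unclaimed[OF t] by simp
    \<comment> \<open>The edge has been unclaimed since turn \<open>s\<close>, and \<open>t\<close>
      precedes \<open>T\<close>, so \<open>no_growth\<close> applies even if
      \<open>Suc t = T\<close>.\<close>
    have "E t (m_edge (Suc t)) \<le> (1 + \<epsilon>) * E s (m_edge (Suc t))"
      using s edge step T_le by (intro E_growth no_growth) auto
    also have "\<dots> \<le> G * r ^ ?k"
      using edge unclaimed_antimono[of s t] s by (intro bound) auto
    finally have E: "E t (m_edge (Suc t)) \<le> G * r ^ ?k" .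
    have "(\<Sum>w<n. net (Suc t) w) \<le> E t (m_edge (Suc t)) * rate (Suc t)"
      using sum_net_le[OF t] by simp
    also have "\<dots> \<le> G * r ^ ?k * (p * (\<mu> - 1))"
      using E rate_le[OF t] rate_nonneg[OF t] P_nonneg[of "t0 - 1" u] r_pos
      by (intro mult_mono) auto
    finally have "(\<Sum>s\<in>crit_turns (Suc t). \<Sum>w<n. net s w)
        \<le> G * (p * (\<mu> - 1)) * (\<Sum>j<?k. r ^ j) + G * r ^ ?k * (p * (\<mu> - 1))"
      unfolding turns using IH fresh by simp
    also have "\<dots> = G * (p * (\<mu> - 1)) * (\<Sum>j<Suc ?k. r ^ j)"
      by (simp only: sum.lessThan_Suc distrib_left mult_ac)
    also have "Suc ?k = card (crit_turns (Suc t))"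
      unfolding turns using fresh by simp
    finally have net: "(\<Sum>s\<in>crit_turns (Suc t). \<Sum>w<n. net s w)
        \<le> G * (p * (\<mu> - 1)) * (\<Sum>j<card (crit_turns (Suc t)). r ^ j)" .
    have "(1 + \<epsilon>) * E (Suc t) e \<le> G * r ^ card (crit_turns (Suc t))"
      if "e \<in> unclaimed (Suc t)" for e
    proof -
      have "E (Suc t) e \<le> \<mu> * p / (1 - \<eta>) * E t (m_edge (Suc t))"
        using critical_E_le[OF t True eta_less_1 that] by simp
      also have "\<dots> \<le> \<mu> * p / (1 - \<eta>) * (G * r ^ ?k)"
        using E mu_gt_1 p0_pos eta_less_1 by (intro mult_left_mono) auto
      finally have "(1 + \<epsilon>) * E (Suc t) e \<le> (1 + \<epsilon>) * (\<mu> * p / (1 - \<eta>) * (G * r ^ ?k))"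
        using eps_pos by (intro mult_left_mono) auto
      also have "\<dots> = r * (G * r ^ ?k)"
        by (simp add: r_def)
      also have "\<dots> = G * r ^ Suc ?k"
        by (simp only: power_Suc mult_ac)
      also have "Suc ?k = card (crit_turns (Suc t))"
        unfolding turns using fresh by simp
      finally show ?thesis .
    qed
    with net step show ?thesis by (intro conjI bexI[of _ "Suc t"]) auto
  qed
qed

lemma critical_net_gain_le:
  "(\<Sum>s\<in>crit_turns T. \<Sum>w<n. net s w) \<le> G * (p * (\<mu> - 1)) / (1 - r)"
proof -
  define k where "k = card (crit_turns T)"
  have "(\<Sum>j<k. r ^ j) = (1 - r ^ k) / (1 - r)"
    using r_less_1 by (simp add: sum_gp_strict)
  also have "\<dots> \<le> 1 / (1 - r)"
    using r_less_1 r_pos by (intro divide_right_mono) auto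
  finally have "G * (p * (\<mu> - 1)) * (\<Sum>j<k. r ^ j) \<le> G * (p * (\<mu> - 1)) * (1 / (1 - r))"
    using P_nonneg[of "t0 - 1" u] p0_pos mu_gt_1 by (intro mult_left_mono) auto
  then show ?thesis
    using critical_turns_decay[OF t0_le_T order_refl] by (simp add: k_def)
qed

text \<open>Summing \<open>total_decrease\<close> telescopes the total potential. It remains to
  bound the accumulated falls below by a suitable multiple of \<open>P (t0 - 1) u\<close>.\<close>

lemma total_descent:
  "\<eta> * (\<Sum>t=t0..T. \<Sum>w<n. fall t w) - G * (p * (\<mu> - 1)) / (1 - r) \<le> tpot (t0 - 1) - tpot T"
proof -
  obtain m where m: "t0 = Suc m" using t0 by (cases t0) auto
  have "(\<Sum>t=t0..T. \<eta> * (\<Sum>w<n. fall t w) - (if crit \<eta> t then \<Sum>w<n. net t w else 0))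
      \<le> (\<Sum>t=t0..T. tpot (t - 1) - tpot t)"
    using t0 T_le eta_pos eta_less_1 by (intro sum_mono total_decrease) auto
  also have "\<dots> = - (\<Sum>t=t0..T. tpot t - tpot (t - 1))"
    by (simp add: sum_negf[symmetric])
  also have "\<dots> = tpot (t0 - 1) - tpot T"
    using sum_telescope''[of m T tpot] t0_le_T by (simp add: m)
  finally have "\<eta> * (\<Sum>t=t0..T. \<Sum>w<n. fall t w) - (\<Sum>t=t0..T. if crit \<eta> t then \<Sum>w<n. net t w else 0)
      \<le> tpot (t0 - 1) - tpot T"
    by (simp add: sum_subtractf sum_distrib_left)
  moreover have "(\<Sum>t=t0..T. if crit \<eta> t then \<Sum>w<n. net t w else 0)
      = (\<Sum>s\<in>crit_turns T. \<Sum>w<n. net s w)"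
    by (intro sum.inter_filter[symmetric]) simp
  ultimately show ?thesis using critical_net_gain_le by linarith
qed

text \<open>The falls of \<open>u\<close> alone add up to at least
  \<open>\<gamma> * P (t0 - 1) u\<close>; by \<open>small\<close>, a fraction \<open>\<eta>\<close>
  of this pays for all critical turns.\<close>

lemma descent_if_u_drops:
  assumes drop: "P T u \<le> (1 - \<gamma>) * P (t0 - 1) u"
    and small: "2 * (p * (\<mu> - 1)) / (1 - r) \<le> \<eta> * \<gamma>"
  shows "tpot T \<le> tpot (t0 - 1)"
proof -
  obtain m where m: "t0 = Suc m" using t0 by (cases t0) auto
  have "P (t0 - 1) u - P T u = - (\<Sum>t=t0..T. P t u - P (t - 1) u)"
    using sum_telescope''[of m T "\<lambda>t. P t u"] t0_le_T by (simp add: m)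
  also have "\<dots> = (\<Sum>t=t0..T. P (t - 1) u - P t u)"
    by (simp add: sum_negf[symmetric])
  also have "\<dots> \<le> (\<Sum>t=t0..T. \<Sum>w<n. fall t w)"
  proof (rule sum_mono)
    fix t assume "t \<in> {t0..T}"
    then have t: "t \<in> {1..length g}" using t0 T_le by auto
    have "P (t - 1) u - P t u \<le> fall t u"
      using net_nonneg[OF t, of u] by (simp add: fall_def)
    also have "\<dots> \<le> (\<Sum>w<n. fall t w)"
      using u_less fall_nonneg[OF t] by (intro member_le_sum) auto
    finally show "P (t - 1) u - P t u \<le> (\<Sum>w<n. fall t w)" .
  qed
  finally have "\<gamma> * P (t0 - 1) u \<le> (\<Sum>t=t0..T. \<Sum>w<n. fall t w)"
    using drop by (simp add: algebra_simps)
  then have "\<eta> * (\<gamma> * P (t0 - 1) u) \<le> \<eta> * (\<Sum>t=t0..T. \<Sum>w<n. fall t w)"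
    using eta_pos by (intro mult_left_mono) auto
  moreover have "G * (p * (\<mu> - 1)) / (1 - r) \<le> \<eta> * (\<gamma> * P (t0 - 1) u)"
    using mult_right_mono[OF small P_nonneg[of "t0 - 1" u]]
    by (simp only: times_divide_eq_left times_divide_eq_right mult_ac)
  ultimately show ?thesis using total_descent by linarith
qed

text \<open>The growth of \<open>w\<close> forces many free edges, each of which costs at least the potential of \<open>u\<close>.\<close>

lemma descent_if_vertex_grows:
  assumes "\<gamma> < 1"
    and stays: "\<And>t. t \<in> {t0..T} \<Longrightarrow> (1 - \<gamma>) * P (t0 - 1) u < P t u"
    and s: "t0 \<le> s" "s < T" and w: "w < n" "0 < P s w" "(1 + \<epsilon>) * P s w \<le> P T w"
    and small: "2 * (p * (\<mu> - 1)) / (1 - r) \<le> \<eta> * ((1 - \<gamma>) * ln (1 + \<epsilon>) / (\<mu> * p))"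
  shows "tpot T \<le> tpot (t0 - 1)"
proof -
  \<comment> \<open>\<open>b\<close> is the loss guaranteed per unit of \<open>rate\<close>, by
    \<open>sum_loss_ge\<close> for an unclaimed edge at \<open>u\<close>.\<close>
  define b where "b = (1 - \<gamma>) * P (t0 - 1) u / (\<mu> * p)"
  have "0 \<le> b"
    unfolding b_def using assms(1) P_nonneg[of "t0 - 1" u] mu_gt_1 p0_pos by simp
  have "(1 + \<epsilon>) * P s w \<le> exp (\<Sum>t\<in>{Suc s..T}. rate t) * P s w"
    using order_trans[OF w(3) pot_growth_interval[of s T w]] s w(1) T_le
    by (simp add: mult.commute)
  then have "1 + \<epsilon> \<le> exp (\<Sum>t\<in>{Suc s..T}. rate t)"
    using w(2) by (rule mult_right_le_imp_le)
  then have "ln (1 + \<epsilon>) \<le> (\<Sum>t\<in>{Suc s..T}. rate t)"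
    using eps_pos by (metis add_pos_pos exp_gt_zero ln_exp ln_le_cancel_iff zero_less_one)
  also have "\<dots> \<le> (\<Sum>t=t0..T. rate t)"
    using s t0 T_le by (intro sum_mono2 rate_nonneg) auto
  finally have "ln (1 + \<epsilon>) * b \<le> (\<Sum>t=t0..T. rate t) * b"
    using \<open>0 \<le> b\<close> by (rule mult_right_mono)
  also have "\<dots> \<le> (\<Sum>t=t0..T. \<Sum>w<n. fall t w)"
    unfolding sum_distrib_right
  proof (rule sum_mono)
    fix t assume tT: "t \<in> {t0..T}"
    then have t: "t \<in> {1..length g}" using t0 T_le by auto
    have "0 \<le> (1 - \<gamma>) * P (t0 - 1) u"
      using assms(1) P_nonneg[of "t0 - 1" u] by simp
    then have "P t u \<noteq> 0" using stays[OF tT] by linarith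
    then obtain e where e: "e \<in> unclaimed t" "u \<in> e"
      using unclaimed_edge_exists[OF u_less] t by (metis atLeastAtMost_iff)
    have "(1 - \<gamma>) * P (t0 - 1) u \<le> E t e"
      using stays[OF tT] edge_pot_ge[of e u "Mg t" "Bg t"] e by (simp add: pot_at_def)
    then have "rate t * b \<le> rate t * (E t e / (\<mu> * p))"
      unfolding b_def using rate_nonneg[OF t] mu_gt_1 p0_pos
      by (intro mult_left_mono divide_right_mono) auto
    also have "\<dots> \<le> (\<Sum>w<n. loss t w)" by (rule sum_loss_ge[OF t e(1)])
    also have "\<dots> \<le> (\<Sum>w<n. fall t w)" by (intro sum_mono loss_le_fall[OF t]) simp
    finally show "rate t * b \<le> (\<Sum>w<n. fall t w)" .
  qed
  finally have "\<eta> * (ln (1 + \<epsilon>) * b) \<le> \<eta> * (\<Sum>t=t0..T. \<Sum>w<n. fall t w)"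
    using eta_pos by (intro mult_left_mono) auto
  moreover have "G * (p * (\<mu> - 1)) / (1 - r) \<le> \<eta> * (ln (1 + \<epsilon>) * b)"
    using mult_right_mono[OF small P_nonneg[of "t0 - 1" u]]
    by (simp only: b_def times_divide_eq_left times_divide_eq_right mult_ac)
  ultimately show ?thesis using total_descent by linarith
qed

text \<open>An edge at \<open>u\<close> unclaimed after \<open>T\<close> was also unclaimed after
  the witness turn of \<open>critical_turns_decay\<close>, so its potential is small;
  \<open>growth\<close> extends \<open>no_growth\<close> to turn \<open>T\<close>. If no such edge
  is left, \<open>u\<close> has potential 0.\<close>

lemma u_drops_after_critical_turns:
  assumes growth: "\<And>s w. \<lbrakk>t0 \<le> s; s < T; w < n; 0 < P s w\<rbrakk> \<Longrightarrow> P T w < (1 + \<epsilon>) * P s w"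
    and many: "r ^ card (crit_turns T) \<le> (1 - \<gamma>) / 2" and "\<gamma> < 1"
  shows "P T u \<le> (1 - \<gamma>) * P (t0 - 1) u"
proof (cases "P T u = 0")
  case True
  then show ?thesis using P_nonneg[of "t0 - 1" u] \<open>\<gamma> < 1\<close> by simp
next
  case False
  then obtain e where e: "e \<in> unclaimed T" "u \<in> e"
    using unclaimed_edge_exists[OF u_less T_le] by metis
  obtain s where s: "s \<in> {t0..T}"
    and bound: "\<And>e. e \<in> unclaimed s \<Longrightarrow> (1 + \<epsilon>) * E s e \<le> G * r ^ card (crit_turns T)"
    using critical_turns_decay[OF t0_le_T order_refl] by blast
  have "P T u \<le> E T e"
    using edge_pot_ge[of e u "Mg T" "Bg T"] e by (simp add: pot_at_def)
  also have "\<dots> \<le> (1 + \<epsilon>) * E s e"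
    using s e T_le by (intro E_growth growth) auto
  also have "\<dots> \<le> G * r ^ card (crit_turns T)"
    using e unclaimed_antimono[of s T] s by (intro bound) auto
  also have "\<dots> \<le> G * ((1 - \<gamma>) / 2)"
    using many P_nonneg[of "t0 - 1" u] by (intro mult_left_mono) auto
  finally show ?thesis by (simp add: mult_ac)
qed

end

subsection \<open>The stopping turns\<close>

text \<open>The infimum of the empty set is infinite, so a finite value belongs to a nonempty set,
  where well-ordering makes the infimum a member.\<close>

lemma first_turn_attained:
  assumes "first_turn g Q = enat T"
  shows "T \<in> {1..length g}" "Q T"
proof -
  let ?A = "enat ` {t \<in> {1..length g}. Q t}"
  have "?A \<noteq> {}"
  proof
    assume empty: "?A = {}"
    have "first_turn g Q = \<infinity>" unfolding first_turn_def empty by (simp add: top_enat_def)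
    then show False using assms by simp
  qed
  then have "Inf ?A \<in> ?A" by (metis wellorder_InfI ex_in_conv)
  then show "T \<in> {1..length g}" "Q T"
    using assms by (auto simp: first_turn_def)
qed

lemma first_turn_le: "t \<in> {1..length g} \<Longrightarrow> Q t \<Longrightarrow> first_turn g Q \<le> enat t"
  unfolding first_turn_def by (intro Inf_lower) auto

text \<open>The denominator in \<open>crit_bound\<close> is minus the logarithm of the decay factor,
  the numerator the logarithm of \<open>2 / (1 - \<gamma>)\<close>. Their quotient is the real
  exponent giving equality, and rounding up keeps the bound.\<close>

lemma power_crit_bound_le:
  assumes "0 < mu \<beta> \<delta> n * p0 \<beta> \<delta>" "\<eta> < 1" "0 < \<epsilon>" "0 < \<gamma>" "\<gamma> < 1"
    and "(1 + \<epsilon>) * (mu \<beta> \<delta> n * p0 \<beta> \<delta>) / (1 - \<eta>) < 1"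
  shows "((1 + \<epsilon>) * (mu \<beta> \<delta> n * p0 \<beta> \<delta>) / (1 - \<eta>)) ^ crit_bound \<beta> \<delta> n \<eta> \<gamma> \<epsilon> \<le> (1 - \<gamma>) / 2"
proof -
  define x where "x = mu \<beta> \<delta> n * p0 \<beta> \<delta>"
  let ?r = "(1 + \<epsilon>) * x / (1 - \<eta>)" and ?c = "crit_bound \<beta> \<delta> n \<eta> \<gamma> \<epsilon>"
  define A where "A = 1 - log 2 (1 - \<gamma>)"
  have x_pos: "0 < x" using assms(1) by (simp add: x_def)
  have r_pos: "0 < ?r" using x_pos assms by simp
  have log_r: "log 2 (1 - \<eta>) - log 2 (1 + \<epsilon>) - log 2 x = - log 2 ?r"
    using x_pos assms(2,3) by (simp add: log_divide log_mult_pos)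
  have neg: "0 < - log 2 ?r" using r_pos assms(6) by (simp add: x_def)
  have "A / (- log 2 ?r) \<le> real ?c"
    unfolding crit_bound_def x_def[symmetric] log_r A_def by linarith
  then have "A \<le> real ?c * (- log 2 ?r)"
    by (rule iffD1[OF pos_divide_le_eq[OF neg]])
  moreover have "log 2 (?r ^ ?c) = real ?c * log 2 ?r"
    using r_pos by (simp add: log_nat_power)
  moreover have "log 2 ((1 - \<gamma>) / 2) = - A"
    using \<open>\<gamma> < 1\<close> by (simp add: A_def log_divide)
  ultimately have "log 2 (?r ^ ?c) \<le> log 2 ((1 - \<gamma>) / 2)" by simp
  then show ?thesis using r_pos \<open>\<gamma> < 1\<close> by (simp add: x_def)
qed

text \<open>If \<open>T\<close> comes from \<open>t3\<close> alone, then \<open>u\<close> has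
  dropped after all by \<open>u_drops_after_critical_turns\<close>. So only a drop of
  \<open>u\<close> or growth of some vertex is left.\<close>

lemma (in strategic_game) descent_at_stopping_turn:
  assumes eta: "0 < \<eta>" "\<eta> < 1" and gamma: "0 < \<gamma>" "\<gamma> < 1" and eps: "0 < \<epsilon>"
    and ratio: "(1 + \<epsilon>) * (\<mu> * p) / (1 - \<eta>) < 1"
    and small1: "2 * (p * (\<mu> - 1)) / (1 - (1 + \<epsilon>) * (\<mu> * p) / (1 - \<eta>)) \<le> \<eta> * \<gamma>"
    and small2: "2 * (p * (\<mu> - 1)) / (1 - (1 + \<epsilon>) * (\<mu> * p) / (1 - \<eta>))
      \<le> \<eta> * ((1 - \<gamma>) * ln (1 + \<epsilon>) / (\<mu> * p))"
    and t0: "t0 \<in> {1..length g}" and increase: "tpot (t0 - 1) < tpot t0"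
    and edge: "m_edge t0 = {u, v}" and label: "P (t0 - 1) v \<le> P (t0 - 1) u"
    and T: "t_star \<beta> \<delta> n \<eta> \<gamma> \<epsilon> g t0 u = enat T"
  shows "tpot T \<le> tpot (t0 - 1)"
proof -
  let ?c = "crit_bound \<beta> \<delta> n \<eta> \<gamma> \<epsilon>"
  consider "t1 \<beta> \<delta> n \<gamma> g t0 u = enat T" | "t2 \<beta> \<delta> n \<epsilon> g t0 = enat T"
    | "t3 \<beta> \<delta> n \<eta> ?c g t0 = enat T"
    using T by (auto simp: t_star_def min_def split: if_splits)
  then have "t0 \<le> T \<and> T \<in> {1..length g}"
    by cases (auto simp: t1_def t2_def t3_def dest: first_turn_attained)
  then have T_bounds: "t0 \<le> T" "T \<le> length g" by auto
  have before_t1: "(1 - \<gamma>) * P (t0 - 1) u < P t u" if "t0 \<le> t" "t < T" for t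
  proof (rule ccontr)
    assume "\<not> ?thesis"
    then have "t1 \<beta> \<delta> n \<gamma> g t0 u \<le> enat t"
      unfolding t1_def using that t0 T_bounds by (intro first_turn_le) auto
    then have "t_star \<beta> \<delta> n \<eta> \<gamma> \<epsilon> g t0 u \<le> enat t" by (simp add: t_star_def min.coboundedI1)
    then show False using T that by simp
  qed
  have growth_t2: "t2 \<beta> \<delta> n \<epsilon> g t0 \<le> enat t"
    if "t0 \<le> s" "s < t" "t \<le> T" "w < n" "0 < P s w" "\<not> P t w < (1 + \<epsilon>) * P s w" for s t w
    unfolding t2_def using that t0 T_bounds
    by (intro first_turn_le conjI exI[of _ w] exI[of _ s]) auto
  have T_le_t2: "enat T \<le> t2 \<beta> \<delta> n \<epsilon> g t0"
    unfolding T[symmetric] t_star_def by (simp add: min.coboundedI2)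
  interpret critical_phase \<beta> \<delta> n g \<eta> \<epsilon> t0 u v T
  proof unfold_locales
    fix s t w assume "t0 \<le> s" "s < t" "t < T" "w < n" "0 < P s w"
    then show "P t w < (1 + \<epsilon>) * P s w"
      using growth_t2[of s t w] T_le_t2 by (metis enat_ord_simps(1) leD less_imp_le order_trans)
  qed (use assms T_bounds in auto)
  show ?thesis
  \<comment> \<open>Several stopping turns may coincide. Deciding first whether \<open>u\<close> has
    dropped ensures in the growth case that \<open>u\<close> stays large up to and including turn
    \<open>T\<close>.\<close>
  proof (cases "P T u \<le> (1 - \<gamma>) * P (t0 - 1) u")
    case True
    then show ?thesis using small1 by (intro descent_if_u_drops) (auto simp: r_def)
  next
    case False
    then have stays: "(1 - \<gamma>) * P (t0 - 1) u < P t u" if "t \<in> {t0..T}" for t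
      using before_t1[of t] that by (cases "t = T") auto
    show ?thesis
    proof (cases "t2 \<beta> \<delta> n \<epsilon> g t0 = enat T")
      case True
      then obtain w s where "w < n" "t0 \<le> s" "s < T" "0 < P s w" "(1 + \<epsilon>) * P s w \<le> P T w"
        unfolding t2_def by (blast dest: first_turn_attained(2))
      then show ?thesis
        using small2 gamma stays by (intro descent_if_vertex_grows) (auto simp: r_def)
    next
      case no_t2: False
      moreover have "t1 \<beta> \<delta> n \<gamma> g t0 u \<noteq> enat T"
        unfolding t1_def using False first_turn_attained(2) by fastforce
      ultimately have "t3 \<beta> \<delta> n \<eta> ?c g t0 = enat T"
        using T by (auto simp: t_star_def min_def split: if_splits)
      then have "card (crit_turns T) = ?c"
        unfolding t3_def by (auto dest: first_turn_attained(2))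
      moreover have "r ^ ?c \<le> (1 - \<gamma>) / 2"
        unfolding r_def using mu_gt_1 p0_pos eta gamma eps ratio
        by (intro power_crit_bound_le) auto
      moreover have "P T w < (1 + \<epsilon>) * P s w" if "t0 \<le> s" "s < T" "w < n" "0 < P s w" for s w
        using growth_t2[of s T w] that T_le_t2 no_t2 by (metis order_antisym order_refl)
      ultimately have "P T u \<le> (1 - \<gamma>) * P (t0 - 1) u"
        using gamma by (intro u_drops_after_critical_turns) auto
      with False show ?thesis by simp
    qed
  qed
qed

section \<open>Asymptotics for large \<open>n\<close>\<close>

lemma mu_tendsto_1:
  assumes "0 < \<beta>" "0 < \<delta>"
  shows "(\<lambda>n. mu \<beta> \<delta> n) \<longlonglongrightarrow> 1"
proof (rule tendsto_sandwich)
  have bias: "sqrt (\<beta> * real n) \<le> real (bias \<beta> n)" for n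
    unfolding bias_def by linarith
  show "\<forall>\<^sub>F n in sequentially. 1 \<le> mu \<beta> \<delta> n"
    using eventually_gt_at_top[of 0] by eventually_elim (use assms in \<open>simp add: mu_def\<close>)
  show "\<forall>\<^sub>F n in sequentially. mu \<beta> \<delta> n \<le> 1 + 6 * \<beta> * ln (real n) / (\<delta> * sqrt (\<beta> * real n))"
    using eventually_gt_at_top[of 0]
  proof eventually_elim
    case (elim n)
    have "0 < sqrt (\<beta> * real n)" using elim assms by simp
    moreover from this have "0 < real (bias \<beta> n)" using bias[of n] by linarith
    \<comment> \<open>The bias is rounded up, so omitting the rounding only enlarges the
      fraction.\<close>
    ultimately have "6 * \<beta> * ln (real n) / (\<delta> * real (bias \<beta> n))
        \<le> 6 * \<beta> * ln (real n) / (\<delta> * sqrt (\<beta> * real n))"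
      using bias[of n] elim assms
      by (intro divide_left_mono mult_left_mono mult_pos_pos) auto
    then show ?case by (simp add: mu_def)
  qed
  show "(\<lambda>n. 1 + 6 * \<beta> * ln (real n) / (\<delta> * sqrt (\<beta> * real n))) \<longlonglongrightarrow> 1"
    using assms by real_asymp
qed simp

lemma mu_gt_1_if:
  assumes "0 < \<beta>" "0 < \<delta>" "1 < n"
  shows "0 < bias \<beta> n" "1 < mu \<beta> \<delta> n"
proof -
  have "0 < sqrt (\<beta> * real n)" using assms by simp
  then show bias: "0 < bias \<beta> n" unfolding bias_def by linarith
  have "0 < 6 * \<beta> * ln (real n) / (\<delta> * real (bias \<beta> n))"
    using assms bias by (intro divide_pos_pos mult_pos_pos) auto
  then show "1 < mu \<beta> \<delta> n" by (simp add: mu_def)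
qed

text \<open>As a function of \<open>m = mu \<beta> \<delta> n\<close>, the difference of the two
  sides is continuous at 1 with value \<open>- h\<close> there.\<close>

lemma eventually_small_net_gain:
  fixes p \<eta> \<epsilon> h :: real
  assumes mu: "(\<lambda>n. mu \<beta> \<delta> n) \<longlonglongrightarrow> 1" and "0 < p" "(1 + \<epsilon>) * p / (1 - \<eta>) < 1" "0 < h"
  shows "\<forall>\<^sub>F n in sequentially. 2 * (p * (mu \<beta> \<delta> n - 1)) /
    (1 - (1 + \<epsilon>) * (mu \<beta> \<delta> n * p) / (1 - \<eta>)) \<le> h / mu \<beta> \<delta> n"
proof -
  let ?f = "\<lambda>m. 2 * (p * (m - 1)) / (1 - (1 + \<epsilon>) * (m * p) / (1 - \<eta>)) - h / m"
  have "isCont ?f 1"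
    \<comment> \<open>For \<open>\<eta> = 1\<close> the inner quotient is 0, since division by 0
      yields 0.\<close>
    using assms by (cases "\<eta> = 1") (auto intro!: continuous_intros simp: divide_eq_eq)
  then have "(\<lambda>n. ?f (mu \<beta> \<delta> n)) \<longlonglongrightarrow> ?f 1"
    using mu by (rule isCont_tendsto_compose)
  then have "\<forall>\<^sub>F n in sequentially. ?f (mu \<beta> \<delta> n) < 0"
    using assms by (intro order_tendstoD(2)) auto
  then show ?thesis by eventually_elim simp
qed

theorem theorem3p7:
  fixes eps_star \<beta> \<delta> \<eta> \<gamma> \<epsilon> :: real
  assumes "eps_star > 0" and "\<beta> = 8 / 3 + eps_star"
    and "0 < \<delta>" and "\<delta> < 1 - 8 / (3 * \<beta>)"
    and "0 < \<eta>"
    and "0 < \<gamma>" and "\<gamma> < 1"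
    and "0 < \<epsilon>"
  shows "\<forall>\<^sub>F n in sequentially.
    \<eta> < 1 - mu \<beta> \<delta> n * p0 \<beta> \<delta> \<longrightarrow>
    (1 - \<eta>) / ((1 + \<epsilon>) * (mu \<beta> \<delta> n * p0 \<beta> \<delta>)) > 1 \<longrightarrow>
    (\<forall>g t0 u v T.
      strategy_game \<beta> \<delta> n g \<longrightarrow>
      (\<forall>t\<in>{1..length g}. \<not> isolation_turn n g t) \<longrightarrow>
      t0 \<in> {1..length g} \<longrightarrow>
      POT \<beta> \<delta> n g t0 > real n \<longrightarrow>
      POT \<beta> \<delta> n g (t0 - 1) \<le> real n \<longrightarrow>
      (\<forall>t<t0. POT \<beta> \<delta> n g t < 2 * real n) \<longrightarrow>
      maker_edge (turn_at g t0) = {u, v} \<longrightarrow>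
      pot_at \<beta> \<delta> n g (t0 - 1) u \<ge> pot_at \<beta> \<delta> n g (t0 - 1) v \<longrightarrow>
      t_star \<beta> \<delta> n \<eta> \<gamma> \<epsilon> g t0 u = enat T \<longrightarrow>
      POT \<beta> \<delta> n g T \<le> POT \<beta> \<delta> n g (t0 - 1))"
proof -
  define p where "p = p0 \<beta> \<delta>"
  have beta: "0 < \<beta>" using assms by simp
  have "8 / 3 < \<beta> * (1 - \<delta>)"
    using assms(4) beta by (simp add: field_simps)
  \<comment> \<open>As \<open>3 + \<delta>\<close> exceeds 3, the denominator of \<open>p\<close>
    exceeds 8.\<close>
  then have "8 / 3 * 3 < \<beta> * (1 - \<delta>) * (3 + \<delta>)"
    using assms(3) by (intro mult_strict_mono) auto
  then have p: "0 < p" "p \<le> 1"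
    by (simp_all add: p_def p0_def)
  \<comment> \<open>The assumption on \<open>\<epsilon>\<close> depends on \<open>n\<close> through
    \<open>mu\<close>. Its consequence with \<open>mu\<close> replaced by 1 does not, so it can be
    decided before \<open>n\<close> is chosen.\<close>
  have ev_ratio: "\<forall>\<^sub>F n in sequentially. (1 + \<epsilon>) * p / (1 - \<eta>) < 1 \<and> \<eta> < 1 \<longrightarrow>
      2 * (p * (mu \<beta> \<delta> n - 1)) / (1 - (1 + \<epsilon>) * (mu \<beta> \<delta> n * p) / (1 - \<eta>)) \<le> \<eta> * \<gamma> / mu \<beta> \<delta> n \<and>
      2 * (p * (mu \<beta> \<delta> n - 1)) / (1 - (1 + \<epsilon>) * (mu \<beta> \<delta> n * p) / (1 - \<eta>))
        \<le> \<eta> * ((1 - \<gamma>) * ln (1 + \<epsilon>) / p) / mu \<beta> \<delta> n"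
  proof (cases "(1 + \<epsilon>) * p / (1 - \<eta>) < 1")
    case True
    note ev = eventually_small_net_gain[OF mu_tendsto_1[OF beta assms(3)] p(1) True]
    have "0 < \<eta> * \<gamma>" "0 < \<eta> * ((1 - \<gamma>) * ln (1 + \<epsilon>) / p)"
      using assms p by simp_all
    from ev[OF this(1)] ev[OF this(2)] show ?thesis by eventually_elim simp
  qed simp
  from ev_ratio eventually_gt_at_top[of 1] show ?thesis
  proof eventually_elim
    case (elim n)
    note mu = mu_gt_1_if[OF beta assms(3) elim(2)]
    show ?case
    proof (intro impI allI)
      fix g t0 u v T
      assume eta: "\<eta> < 1 - mu \<beta> \<delta> n * p0 \<beta> \<delta>"
        and ratio: "1 < (1 - \<eta>) / ((1 + \<epsilon>) * (mu \<beta> \<delta> n * p0 \<beta> \<delta>))"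
        and game: "strategy_game \<beta> \<delta> n g" "\<forall>t\<in>{1..length g}. \<not> isolation_turn n g t"
        and t0: "t0 \<in> {1..length g}" "POT \<beta> \<delta> n g t0 > real n" "POT \<beta> \<delta> n g (t0 - 1) \<le> real n"
        and uv: "maker_edge (turn_at g t0) = {u, v}"
          "pot_at \<beta> \<delta> n g (t0 - 1) u \<ge> pot_at \<beta> \<delta> n g (t0 - 1) v"
        and T: "t_star \<beta> \<delta> n \<eta> \<gamma> \<epsilon> g t0 u = enat T"
      interpret strategic_game \<beta> \<delta> n g
        using mu p game by unfold_locales (auto simp: p_def)
      have pos: "0 < mu \<beta> \<delta> n * p" using mu(2) p(1) by simp
      then have eta1: "\<eta> < 1" using eta by (simp add: p_def)
      have less: "(1 + \<epsilon>) * (mu \<beta> \<delta> n * p) < 1 - \<eta>"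
        using ratio pos assms(8) by (simp add: p_def less_divide_eq)
      have "1 * p \<le> mu \<beta> \<delta> n * p" using mu(2) p(1) by (intro mult_right_mono) auto
      then have "(1 + \<epsilon>) * p \<le> (1 + \<epsilon>) * (mu \<beta> \<delta> n * p)"
        using assms(8) by (intro mult_left_mono) auto
      then have "(1 + \<epsilon>) * p / (1 - \<eta>) < 1" using less eta1 by simp
      then have small:
        "2 * (p * (mu \<beta> \<delta> n - 1)) / (1 - (1 + \<epsilon>) * (mu \<beta> \<delta> n * p) / (1 - \<eta>)) \<le> \<eta> * \<gamma> / mu \<beta> \<delta> n"
        "2 * (p * (mu \<beta> \<delta> n - 1)) / (1 - (1 + \<epsilon>) * (mu \<beta> \<delta> n * p) / (1 - \<eta>))
          \<le> \<eta> * ((1 - \<gamma>) * ln (1 + \<epsilon>) / p) / mu \<beta> \<delta> n"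
        using elim(1) eta1 by auto
      have "\<eta> * \<gamma> / mu \<beta> \<delta> n \<le> \<eta> * \<gamma> / 1"
        using mu(2) assms(5,6) by (intro divide_left_mono) auto
      then have "\<eta> * \<gamma> / mu \<beta> \<delta> n \<le> \<eta> * \<gamma>" by simp
      with small(1) have small1:
        "2 * (p * (mu \<beta> \<delta> n - 1)) / (1 - (1 + \<epsilon>) * (mu \<beta> \<delta> n * p) / (1 - \<eta>)) \<le> \<eta> * \<gamma>"
        by (rule order_trans)
      have small2: "2 * (p * (mu \<beta> \<delta> n - 1)) / (1 - (1 + \<epsilon>) * (mu \<beta> \<delta> n * p) / (1 - \<eta>))
          \<le> \<eta> * ((1 - \<gamma>) * ln (1 + \<epsilon>) / (mu \<beta> \<delta> n * p))"
        using small(2) by (simp only: times_divide_eq_right divide_divide_eq_left mult_ac)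
      show "POT \<beta> \<delta> n g T \<le> POT \<beta> \<delta> n g (t0 - 1)"
      proof (rule descent_at_stopping_turn[OF assms(5) eta1 assms(6,7,8)])
        show "(1 + \<epsilon>) * (mu \<beta> \<delta> n * p0 \<beta> \<delta>) / (1 - \<eta>) < 1"
          using less eta1 by (simp add: p_def)
      qed (use small1 small2 t0 uv T in \<open>simp_all add: p_def\<close>)
    qed
  qed
qed

end
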